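(* Let $\{g_\ell\}_{\ell\in\mathbb{N}}$ be a sequence of continuous $g$-functions on $X=A^{\mathbb{N}}$ such that each $g_\ell$ is locally constant of range $\ell+1$, and suppose $g_\ell\to g$ in the sup-norm. If \[ \lim_{\ell\to\infty}\|\log(g/g_\ell)\|\,e^{\operatorname{svar}_\ell(\log\circ g_\ell)}=0, \] then the sequence $\{\mu_\ell\}_{\ell\in\mathbb{N}}$, where $\mu_\ell$ is the unique compatible $g_\ell$-measure, converges in the projective distance $\rho$, and its limit $\mu$ is the unique compatible $g$-measure.
   Context: $A$ is a finite alphabet, $X=A^{\mathbb{N}}$ with product topology, $T$ the left shift, $\pmb{x}_n^m=x_n\cdots x_m$, $[\pmb{a}]=\{\pmb{x}:\pmb{x}_1^n=\pmb{a}\}$ for $\pmb{a}\in A^n$. $\mathcal{M}^+(X)$: Borel probability measures positive on every cylinder. Projective distance: $\rho(\mu,\nu)=\sup_{n}\max_{\pmb{a}\in A^n}\frac1n|\log(\mu[\pmb{a}]/\nu[\pmb{a}])|$. A ($g$-function) is a continuous $g:X\to(0,1)$ with $\sum_{a\in A}g(a x_2x_3\cdots)=1$ for all $\pmb{x}$. A compatible $g$-measure is a $T$-invariant $\mu\in\mathcal{M}^+(X)$ with $\lim_{n\to\infty}\mu[a_1\pmb{a}_2^n]/\mu[\pmb{a}_2^n]=g(\pmb{a})$ for all $\pmb{a}\in X$. A function $\phi$ is locally constant of range $\ell$ if $\pmb{x}_1^\ell=\pmb{y}_1^\ell$ implies $\phi(\pmb{x})=\phi(\pmb{y})$ (a $g$-function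 locally constant of range $\ell+1$ has a unique compatible $g$-measure, which is an $\ell$-step Markov measure). $\|\cdot\|$ is the sup-norm. $\operatorname{var}_k\phi=\max_{\pmb{a}\in A^k}\{\sup_{[\pmb{a}]}\phi-\inf_{[\pmb{a}]}\phi\}$ and $\operatorname{svar}_\ell\phi=\sum_{k=1}^\ell\operatorname{var}_k\phi$. *)

theory Defs
  imports "HOL-Probability.Probability"
begin

text \<open>Sequence space X = A^N, with A a finite type 'a; sequences are indexed from 0,
  so the paper's x_1 x_2 ... is x 0, x 1, ...\<close>

definition Xtop :: "(nat \<Rightarrow> 'a) topology" where
  "Xtop = product_topology (\<lambda>_. discrete_topology UNIV) UNIV"

definition borelX :: "(nat \<Rightarrow> 'a) measure" where
  "borelX = sigma (topspace Xtop) {S. openin Xtop S}"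

definition shiftT :: "(nat \<Rightarrow> 'a) \<Rightarrow> (nat \<Rightarrow> 'a)" where
  "shiftT x = (\<lambda>i. x (Suc i))"

definition cyl :: "'a list \<Rightarrow> (nat \<Rightarrow> 'a) set" where
  "cyl w = {x. \<forall>i < length w. x i = w ! i}"

text \<open>Word x_{m+1} ... x_n (paper indexing), i.e. entries m..n-1 (0-based).\<close>
definition word :: "(nat \<Rightarrow> 'a) \<Rightarrow> nat \<Rightarrow> nat \<Rightarrow> 'a list" where
  "word x m n = map x [m..<n]"

definition Mplus :: "(nat \<Rightarrow> 'a::finite) measure \<Rightarrow> bool" where
  "Mplus \<mu> \<longleftrightarrow> prob_space \<mu> \<and> sets \<mu> = sets borelX \<and> space \<mu> = UNIV
      \<and> (\<forall>w. measure \<mu> (cyl w) > 0)"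

definition proj_dist :: "(nat \<Rightarrow> 'a::finite) measure \<Rightarrow> (nat \<Rightarrow> 'a) measure \<Rightarrow> ereal" where
  "proj_dist \<mu> \<nu> = (SUP n \<in> {1..}. SUP w \<in> {w. length w = n}.
      ereal (\<bar>ln (measure \<mu> (cyl w) / measure \<nu> (cyl w))\<bar> / real n))"

definition g_function :: "((nat \<Rightarrow> 'a::finite) \<Rightarrow> real) \<Rightarrow> bool" where
  "g_function g \<longleftrightarrow> continuous_map Xtop euclideanreal g
      \<and> (\<forall>x. 0 < g x \<and> g x < 1)
      \<and> (\<forall>x. (\<Sum>a\<in>UNIV. g (case_nat a (shiftT x))) = 1)"

definition compatible_g_measure :: "((nat \<Rightarrow> 'a::finite) \<Rightarrow> real) \<Rightarrow> (nat \<Rightarrow> 'a) measure \<Rightarrow> bool" where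
  "compatible_g_measure g \<mu> \<longleftrightarrow> Mplus \<mu>
      \<and> (\<forall>A \<in> sets \<mu>. emeasure \<mu> (shiftT -` A) = emeasure \<mu> A)
      \<and> (\<forall>x. (\<lambda>n. measure \<mu> (cyl (word x 0 n)) / measure \<mu> (cyl (word x 1 n)))
                \<longlonglongrightarrow> g x)"

definition locally_constant :: "nat \<Rightarrow> ((nat \<Rightarrow> 'a) \<Rightarrow> 'b) \<Rightarrow> bool" where
  "locally_constant l \<phi> \<longleftrightarrow> (\<forall>x y. (\<forall>i<l. x i = y i) \<longrightarrow> \<phi> x = \<phi> y)"

definition supnorm :: "((nat \<Rightarrow> 'a) \<Rightarrow> real) \<Rightarrow> real" where
  "supnorm \<phi> = (SUP x. \<bar>\<phi> x\<bar>)"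

definition var :: "nat \<Rightarrow> ((nat \<Rightarrow> 'a::finite) \<Rightarrow> real) \<Rightarrow> real" where
  "var k \<phi> = Max ((\<lambda>w. (SUP x \<in> cyl w. \<phi> x) - (INF x \<in> cyl w. \<phi> x)) ` {w. length w = k})"

definition svar :: "nat \<Rightarrow> ((nat \<Rightarrow> 'a::finite) \<Rightarrow> real) \<Rightarrow> real" where
  "svar l \<phi> = (\<Sum>k=1..l. var k \<phi>)"

end

theory Submission
  imports Defs
begin

text \<open>
  Let \<open>L\<close> be the transfer operator of \<open>g\<^sub>l\<close> and \<open>f\<close> the indicator of a cylinder \<open>[w]\<close> with
  \<open>|w| \<le> l\<close>. Coupling the chains started from two pasts gives
  \<open>var\<^sub>k (L h) \<le> q\<^sub>k\<^sub>+\<^sub>1 var\<^sub>k\<^sub>+\<^sub>1 h + (1 - q\<^sub>k\<^sub>+\<^sub>1) var\<^sub>0 h\<close> with \<open>q\<^sub>k = exp (- var\<^sub>k (log g\<^sub>l))\<close>. Summing over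
  the iterates \<open>h = L\<^sup>j f\<close> and using \<open>var\<^sub>l (L\<^sup>j f) = 0\<close> yields
  \<open>\<Sum>\<^sub>j var\<^sub>0 (L\<^sup>j f) \<le> |w| exp (svar\<^sub>l (log g\<^sub>l))\<close>: the house-of-cards process with success
  probabilities \<open>q\<^sub>k\<close> visits \<open>0\<close> on average \<open>1 / (q\<^sub>1 \<cdots> q\<^sub>l)\<close> times before it reaches \<open>l\<close>.
  A telescoping sum then shows that the measure of a cylinder \<open>[w]\<close> under any \<open>g'\<close>-measure with
  \<open>\<parallel>log (g' / g\<^sub>l)\<parallel> \<le> \<delta>\<close> differs from \<open>\<mu>\<^sub>l [w]\<close> by at most
  \<open>(exp \<delta> - 1) |w| exp (svar\<^sub>l (log g\<^sub>l))\<close>, without an extra factor \<open>l\<close>. For \<open>g' = g\<close> this is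
  uniqueness and for \<open>g' = g\<^sub>m\<close> with \<open>m\<close> large it shows that \<open>\<mu>\<^sub>l [w]\<close> is Cauchy; the limits are the
  cylinder probabilities of a compatible \<open>g\<close>-measure.

  In the projective distance, long words are handled by
  \<open>|log (\<mu>\<^sub>l [w] / \<mu> [w])| \<le> n \<parallel>log (g / g\<^sub>l)\<parallel> + 2 \<Sum>\<^sub>k\<^sub>\<le>\<^sub>n var\<^sub>k (log g)\<close> for \<open>|w| = n\<close>, where the
  sum is \<open>o(n)\<close> by continuity, and the finitely many short words by convergence on cylinders.
\<close>

section \<open>The sequence space and its cylinders\<close>

lemma topspace_Xtop [simp]: "topspace Xtop = UNIV"
  by (simp add: Xtop_def)

lemma compact_space_Xtop: "compact_space (Xtop :: (nat \<Rightarrow> 'a::finite) topology)"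
  unfolding Xtop_def
  by (simp add: compact_space_product_topology compact_space_discrete_topology)

lemma cyl_word: "cyl (word x 0 n) = {y. \<forall>i<n. y i = x i}"
  by (auto simp: cyl_def word_def)

lemma length_word [simp]: "length (word x m n) = n - m"
  by (simp add: word_def)

lemma cyl_Cons: "cyl (a # w) = {x. x 0 = a \<and> shiftT x \<in> cyl w}"
proof (intro set_eqI iffI)
  fix x assume x: "x \<in> cyl (a # w)"
  have "x 0 = a" using x by (auto simp: cyl_def)
  moreover have "x (Suc i) = w ! i" if "i < length w" for i
    using x that by (auto simp: cyl_def dest: spec[of _ "Suc i"])
  ultimately show "x \<in> {x. x 0 = a \<and> shiftT x \<in> cyl w}" by (auto simp: cyl_def shiftT_def)
qed (auto simp: cyl_def shiftT_def less_Suc_eq_0_disj)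

lemma cyl_snoc: "cyl (w @ [a]) = {x \<in> cyl w. x (length w) = a}"
  by (auto simp: cyl_def nth_append less_Suc_eq)

lemma cyl_Nil [simp]: "cyl [] = UNIV"
  by (simp add: cyl_def)

lemma cyl_nonempty: "cyl w \<noteq> {}"
proof -
  have "(\<lambda>i. w ! i) \<in> cyl w" by (simp add: cyl_def)
  then show ?thesis by blast
qed

text \<open>A basic open set of the product constrains finitely many coordinates, so it contains an
  initial cylinder around each of its points; initial cylinders are themselves basic. Both uniform
  continuity and the description of the Borel sets rest on this.\<close>

lemma openin_Xtop_iff: "openin Xtop S \<longleftrightarrow> (\<forall>x\<in>S. \<exists>n. cyl (word x 0 n) \<subseteq> S)"
proof
  assume S: "openin Xtop S"
  show "\<forall>x\<in>S. \<exists>n. cyl (word x 0 n) \<subseteq> S"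
  proof
    fix x assume "x \<in> S"
    then obtain U where U: "finite {i. U i \<noteq> UNIV}" "x \<in> PiE UNIV U" "PiE UNIV U \<subseteq> S"
      using S unfolding Xtop_def openin_product_topology_alt by auto
    then obtain n where n: "\<forall>i\<in>{i. U i \<noteq> UNIV}. i < n"
      using finite_nat_set_iff_bounded by blast
    have "cyl (word x 0 n) \<subseteq> PiE UNIV U"
    proof
      fix y assume y: "y \<in> cyl (word x 0 n)"
      have "y i \<in> U i" for i
      proof (cases "i < n")
        case True
        then show ?thesis using y U(2) by (auto simp: cyl_word PiE_iff)
      next
        case False
        then have "U i = UNIV" using n by blast
        then show ?thesis by simp
      qed
      then show "y \<in> PiE UNIV U" by auto
    qed
    with U(3) show "\<exists>n. cyl (word x 0 n) \<subseteq> S" by blast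
  qed
next
  assume S: "\<forall>x\<in>S. \<exists>n. cyl (word x 0 n) \<subseteq> S"
  show "openin Xtop S"
    unfolding Xtop_def openin_product_topology_alt
  proof (intro ballI)
    fix x assume "x \<in> S"
    then obtain n where n: "cyl (word x 0 n) \<subseteq> S" using S by blast
    define U where "U i = (if i < n then {x i} else UNIV)" for i
    have "y \<in> PiE UNIV U \<longleftrightarrow> y \<in> cyl (word x 0 n)" for y
      unfolding PiE_UNIV_domain by (auto simp: U_def cyl_word Pi_iff split: if_splits)
    then have "PiE UNIV U = cyl (word x 0 n)" by blast
    then have "x \<in> PiE UNIV U \<and> PiE UNIV U \<subseteq> S" using n by (simp add: cyl_word)
    moreover have "finite {i. U i \<noteq> UNIV}"
      by (rule finite_subset[of _ "{..<n}"]) (auto simp: U_def)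
    ultimately show "\<exists>U. finite {i \<in> UNIV. U i \<noteq> topspace (discrete_topology UNIV)} \<and>
         (\<forall>i\<in>UNIV. openin (discrete_topology UNIV) (U i)) \<and> x \<in> Pi\<^sub>E UNIV U \<and> Pi\<^sub>E UNIV U \<subseteq> S"
      by (intro exI[of _ U]) simp
  qed
qed

lemma openin_cyl: "openin Xtop (cyl w)"
  unfolding openin_Xtop_iff
proof
  fix x assume "x \<in> cyl w"
  then have "cyl (word x 0 (length w)) \<subseteq> cyl w" unfolding cyl_word by (auto simp: cyl_def)
  then show "\<exists>n. cyl (word x 0 n) \<subseteq> cyl w" ..
qed

text \<open>Heine-Cantor: around each point choose a cylinder on which \<open>h\<close> stays within
  \<open>e/2\<close> of its value there. Finitely many of them cover the compact space, and the
  greatest of their lengths is the required \<open>n\<close>.\<close>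

lemma uniform_continuity_Xtop:
  fixes h :: "(nat \<Rightarrow> 'a::finite) \<Rightarrow> real"
  assumes h: "continuous_map Xtop euclideanreal h" and e: "e > 0"
  shows "\<exists>n. \<forall>x y. (\<forall>i<n. x i = y i) \<longrightarrow> \<bar>h x - h y\<bar> < e"
proof -
  have ex: "\<exists>n. \<forall>y\<in>cyl (word x 0 n). \<bar>h y - h x\<bar> < e/2" for x
  proof -
    have "openin Xtop {z \<in> topspace Xtop. h z \<in> ball (h x) (e/2)}"
      using h by (rule openin_continuous_map_preimage) simp
    moreover have "x \<in> {z \<in> topspace Xtop. h z \<in> ball (h x) (e/2)}" using e by simp
    ultimately obtain n where "cyl (word x 0 n) \<subseteq> {z \<in> topspace Xtop. h z \<in> ball (h x) (e/2)}"
      unfolding openin_Xtop_iff by blast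
    then show ?thesis by (auto simp: dist_real_def abs_minus_commute subset_iff)
  qed
  then obtain N where N: "\<And>x y. y \<in> cyl (word x 0 (N x)) \<Longrightarrow> \<bar>h y - h x\<bar> < e/2" by metis
  have "compactin (Xtop :: (nat \<Rightarrow> 'a) topology) UNIV"
    using compact_space_Xtop[where 'a='a] by (simp add: compact_space_def)
  moreover have "openin Xtop U" if "U \<in> range (\<lambda>x. cyl (word x 0 (N x)))" for U
    using that by (auto simp: openin_cyl)
  moreover have "(UNIV :: (nat \<Rightarrow> 'a) set) \<subseteq> \<Union>(range (\<lambda>x. cyl (word x 0 (N x))))"
    by (auto simp: cyl_word)
  ultimately have "\<exists>F. finite F \<and> F \<subseteq> range (\<lambda>x. cyl (word x 0 (N x))) \<and> UNIV \<subseteq> \<Union>F"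
    by (rule compactinD)
  then obtain F where F: "finite F" "F \<subseteq> range (\<lambda>x. cyl (word x 0 (N x)))" "(UNIV :: (nat \<Rightarrow> 'a) set) \<subseteq> \<Union>F" by blast
  obtain C where "finite C" "F = (\<lambda>x. cyl (word x 0 (N x))) ` C"
    using finite_subset_image[OF F(1,2)] by blast
  with F(3) have C: "finite C" "(UNIV :: (nat \<Rightarrow> 'a) set) \<subseteq> (\<Union>x\<in>C. cyl (word x 0 (N x)))" by simp_all
  have "\<forall>x y. (\<forall>i<Max (N ` C). x i = y i) \<longrightarrow> \<bar>h x - h y\<bar> < e"
  proof (intro allI impI)
    fix x y :: "nat \<Rightarrow> 'a" assume xy: "\<forall>i<Max (N ` C). x i = y i"
    from C(2) obtain c where c: "c \<in> C" "x \<in> cyl (word c 0 (N c))" by blast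
    have "N c \<le> Max (N ` C)" using c C by simp
    then have "y \<in> cyl (word c 0 (N c))" using c(2) xy by (auto simp: cyl_word)
    with N[OF c(2)] N[OF this] show "\<bar>h x - h y\<bar> < e" by linarith
  qed
  then show ?thesis by blast
qed

lemma bounded_continuous_Xtop:
  fixes h :: "(nat \<Rightarrow> 'a::finite) \<Rightarrow> real"
  assumes h: "continuous_map Xtop euclideanreal h"
  shows "\<exists>B. \<forall>x. \<bar>h x\<bar> \<le> B"
proof -
  have "compactin euclideanreal (h ` UNIV)"
    using image_compactin[OF _ h, of UNIV] compact_space_Xtop[where 'a='a]
    by (simp add: compact_space_def)
  then have "bounded (range h)" by (simp add: compact_imp_bounded)
  then show ?thesis by (auto simp: bounded_iff)
qed

section \<open>Borel sets and measures determined by cylinders\<close>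

lemma space_borelX [simp]: "space borelX = UNIV"
  and sets_borelX_open: "sets borelX = sigma_sets UNIV {S. openin Xtop S}"
  by (auto simp: borelX_def)

text \<open>There are only countably many words, so this writes every open set as a countable union
  of cylinders.\<close>

lemma Union_cyl_openin:
  fixes S :: "(nat \<Rightarrow> 'a::finite) set"
  assumes "openin Xtop S"
  shows "(\<Union>w\<in>{w. cyl w \<subseteq> S}. cyl w) = S"
proof -
  have "x \<in> (\<Union>w\<in>{w. cyl w \<subseteq> S}. cyl w)" if x: "x \<in> S" for x
  proof -
    obtain n where "cyl (word x 0 n) \<subseteq> S" using assms x unfolding openin_Xtop_iff by blast
    moreover have "x \<in> cyl (word x 0 n)" by (auto simp: cyl_word)
    ultimately show ?thesis by blast
  qed
  then show ?thesis by blast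
qed

lemma sets_borelX: "sets (borelX :: (nat \<Rightarrow> 'a::finite) measure) = sigma_sets UNIV (range cyl)"
proof
  interpret sigma_algebra UNIV "sigma_sets UNIV (range (cyl :: 'a list \<Rightarrow> _))"
    by (rule sigma_algebra_sigma_sets) simp
  have "S \<in> sigma_sets UNIV (range cyl)" if "openin Xtop S" for S :: "(nat \<Rightarrow> 'a) set"
  proof -
    have "(\<Union>w\<in>{w. cyl w \<subseteq> S}. cyl w) \<in> sigma_sets UNIV (range cyl)"
      by (rule countable_UN''[OF countableI_type]) (blast intro: sigma_sets.Basic)
    then show ?thesis using Union_cyl_openin[OF that] by simp
  qed
  then show "sets (borelX :: (nat \<Rightarrow> 'a) measure) \<subseteq> sigma_sets UNIV (range cyl)"
    unfolding sets_borelX_open by (intro sigma_sets_mono) auto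
  show "sigma_sets UNIV (range cyl) \<subseteq> sets (borelX :: (nat \<Rightarrow> 'a) measure)"
    unfolding sets_borelX_open by (intro sigma_sets_mono) (auto simp: openin_cyl)
qed

lemma cyl_in_borelX [measurable]: "cyl w \<in> sets (borelX :: (nat \<Rightarrow> 'a::finite) measure)"
  by (auto simp: sets_borelX)

text \<open>Two cylinders are either nested or disjoint. The empty set is adjoined because no
  cylinder is empty.\<close>

lemma Int_stable_cyl: "Int_stable (insert {} (range cyl))"
proof (rule Int_stableI)
  have sub: "cyl v \<subseteq> cyl w \<or> cyl v \<inter> cyl w = {}" if vw: "length w \<le> length v" for v w :: "'b list"
  proof (cases "take (length w) v = w")
    case True
    then have "v ! i = w ! i" if "i < length w" for i using that by (metis nth_take)
    then show ?thesis using that by (auto simp: cyl_def)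
  next
    case False
    then obtain i where "i < length w" "v ! i \<noteq> w ! i"
      using vw nth_equalityI[of "take (length w) v" w] by (auto simp: min_absorb2)
    then have "cyl v \<inter> cyl w = {}" using that by (force simp: cyl_def)
    then show ?thesis ..
  qed
  fix A B :: "(nat \<Rightarrow> 'b) set" assume "A \<in> insert {} (range cyl)" "B \<in> insert {} (range cyl)"
  then consider "A \<inter> B = {}" | v w where "A = cyl v" "B = cyl w" by blast
  then show "A \<inter> B \<in> insert {} (range cyl)"
  proof cases
    case 2
    then consider "A \<inter> B = {}" | "A \<subseteq> B" | "B \<subseteq> A"
      using sub[of v w] sub[of w v] nat_le_linear[of "length v" "length w"] by (auto simp: Int_commute)
    then show ?thesis
    proof cases
      case 2
      then have "A \<inter> B = cyl v" using \<open>A = cyl v\<close> by blast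
      then show ?thesis by simp
    next
      case 3
      then have "A \<inter> B = cyl w" using \<open>B = cyl w\<close> by blast
      then show ?thesis by simp
    qed simp
  qed simp
qed

lemma measure_eqI_cyl:
  fixes \<mu> \<nu> :: "(nat \<Rightarrow> 'a::finite) measure"
  assumes "prob_space \<mu>" "prob_space \<nu>" "sets \<mu> = sets borelX" "sets \<nu> = sets borelX"
    and eq: "\<And>w. measure \<mu> (cyl w) = measure \<nu> (cyl w)"
  shows "\<mu> = \<nu>"
proof (rule measure_eqI_generator_eq)
  interpret m: prob_space \<mu> by fact
  interpret n: prob_space \<nu> by fact
  show "Int_stable (insert {} (range (cyl :: 'a list \<Rightarrow> _)))" by (rule Int_stable_cyl)
  show "emeasure \<mu> X = emeasure \<nu> X" if "X \<in> insert {} (range cyl)" for X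
    using that eq by (auto simp: m.emeasure_eq_measure n.emeasure_eq_measure)
  have "sigma_sets UNIV (insert {} (range cyl)) = sigma_sets UNIV (range (cyl :: 'a list \<Rightarrow> _))"
    by (intro antisym sigma_sets_mono) (auto intro: sigma_sets.Empty)
  then show "sets \<mu> = sigma_sets UNIV (insert {} (range cyl))"
    "sets \<nu> = sigma_sets UNIV (insert {} (range cyl))"
    using assms sets_borelX by auto
  show "range (\<lambda>_. cyl []) \<subseteq> insert {} (range (cyl :: 'a list \<Rightarrow> _))" by blast
  show "emeasure \<mu> (cyl []) \<noteq> \<infinity>" using m.emeasure_finite[of "cyl []"] by simp
qed auto

lemma shiftT_vimage_cyl: "shiftT -` cyl w = (\<Union>a. cyl (a # w))"
  by (auto simp: cyl_Cons)

lemma measurable_shiftT [measurable]: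
  "(shiftT :: (nat \<Rightarrow> 'a::finite) \<Rightarrow> _) \<in> measurable borelX borelX"
  by (rule measurable_sigma_sets[OF sets_borelX]) (auto simp: shiftT_vimage_cyl)

text \<open>The two sum rules are Kolmogorov consistency (last letter) and shift invariance (first
  letter). Functions on words allow limits to be taken before a limit measure exists;
  \<open>cyl_law_measure\<close> and \<open>measure_of_cyl_law\<close> translate between the two
  views.\<close>

definition cyl_law :: "('a::finite list \<Rightarrow> real) \<Rightarrow> bool" where
  "cyl_law p \<longleftrightarrow> p [] = 1 \<and> (\<forall>w. p w > 0)
     \<and> (\<forall>w. p w = (\<Sum>a\<in>UNIV. p (w @ [a]))) \<and> (\<forall>w. p w = (\<Sum>a\<in>UNIV. p (a # w)))"

lemma cyl_law_measure:
  fixes \<mu> :: "(nat \<Rightarrow> 'a::finite) measure"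
  assumes M: "Mplus \<mu>" and inv: "\<And>A. A \<in> sets \<mu> \<Longrightarrow> emeasure \<mu> (shiftT -` A) = emeasure \<mu> A"
  shows "cyl_law (\<lambda>w. measure \<mu> (cyl w))"
proof -
  interpret prob_space \<mu> using M by (simp add: Mplus_def)
  have s: "sets \<mu> = sets borelX" "space \<mu> = UNIV" and pos: "\<And>w. measure \<mu> (cyl w) > 0"
    using M by (auto simp: Mplus_def)
  have [simp]: "cyl w \<in> sets \<mu>" for w using s by simp
  have "measure \<mu> (cyl w) = (\<Sum>a\<in>UNIV. measure \<mu> (cyl (w @ [a])))" for w
  proof -
    have "cyl w = (\<Union>a\<in>UNIV. cyl (w @ [a]))" by (auto simp: cyl_snoc)
    moreover have "measure \<mu> (\<Union>a\<in>UNIV. cyl (w @ [a])) = (\<Sum>a\<in>UNIV. measure \<mu> (cyl (w @ [a])))"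
      by (rule finite_measure_finite_Union) (simp, simp add: image_subset_iff, auto simp: disjoint_family_on_def cyl_snoc)
    ultimately show ?thesis by simp
  qed
  moreover have "measure \<mu> (cyl w) = (\<Sum>a\<in>UNIV. measure \<mu> (cyl (a # w)))" for w
  proof -
    have "measure \<mu> (cyl w) = measure \<mu> (shiftT -` cyl w)" using inv by (simp add: measure_def)
    also have "\<dots> = (\<Sum>a\<in>UNIV. measure \<mu> (cyl (a # w)))" unfolding shiftT_vimage_cyl
      by (rule finite_measure_finite_Union) (simp, simp add: image_subset_iff, auto simp: disjoint_family_on_def cyl_Cons)
    finally show ?thesis .
  qed
  moreover have "measure \<mu> (cyl []) = 1" using prob_space s by simp
  ultimately show ?thesis using pos unfolding cyl_law_def by blast
qed

section \<open>Perturbation bound for block chains\<close>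

lemma finite_words [simp]: "finite {w :: 'a::finite list. length w = n}"
  using finite_lists_length_eq[of "UNIV :: 'a set" n] by simp

lemma sum_words_Cons:
  "(\<Sum>u | length u = Suc n. f u) = (\<Sum>v | length v = n. \<Sum>a\<in>UNIV. f (a # v))"
  for f :: "'a::finite list \<Rightarrow> real"
  unfolding sum.cartesian_product
  by (rule sum.reindex_bij_witness[of _ "\<lambda>(v, a). a # v" "\<lambda>u. (tl u, hd u)"])
     (auto simp: length_Suc_conv)

lemma sum_words_snoc:
  "(\<Sum>u | length u = Suc n. f u) = (\<Sum>v | length v = n. \<Sum>a\<in>UNIV. f (v @ [a]))"
  for f :: "'a::finite list \<Rightarrow> real"
  unfolding sum.cartesian_product
  by (rule sum.reindex_bij_witness[of _ "\<lambda>(v, a). v @ [a]" "\<lambda>u. (butlast u, last u)"])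
     (auto simp: length_Suc_conv_rev)

lemma
  assumes "cyl_law p"
  shows cyl_law_Nil: "p [] = 1"
    and cyl_law_pos: "0 < p w"
    and cyl_law_snoc: "(\<Sum>a\<in>UNIV. p (w @ [a])) = p w"
    and cyl_law_Cons: "(\<Sum>a\<in>UNIV. p (a # w)) = p w"
  using assms unfolding cyl_law_def by metis+

lemma cyl_law_sum_append:
  assumes "cyl_law p"
  shows "p w = (\<Sum>u | length u = n. p (w @ u))"
proof (induction n)
  case 0
  then show ?case by simp
next
  case (Suc n)
  have "(\<Sum>u | length u = Suc n. p (w @ u)) = (\<Sum>v | length v = n. \<Sum>a\<in>UNIV. p (w @ v @ [a]))"
    by (rule sum_words_snoc)
  also have "\<dots> = (\<Sum>v | length v = n. p (w @ v))"
    using cyl_law_snoc[OF assms, of "w @ _"] by (intro sum.cong refl) simp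
  finally show ?case using Suc by simp
qed

lemma cyl_law_sum_words: "cyl_law p \<Longrightarrow> (\<Sum>u | length u = n. p u) = 1"
  using cyl_law_sum_append[of p "[]" n] cyl_law_Nil[of p] by simp

text \<open>Both sums are compared with multiples of the minimum \<open>c\<close> of
  \<open>y\<close>, since \<open>x\<close> never exceeds \<open>c + d\<close>. Only the total masses
  of the two weights have to agree, which suits the parts left over by a coupling.\<close>

lemma weighted_sums_diff_le:
  fixes \<alpha> \<beta> x y :: "'b \<Rightarrow> real"
  assumes fin: "finite A" and ne: "A \<noteq> {}"
    and nonneg: "\<And>a. a \<in> A \<Longrightarrow> 0 \<le> \<alpha> a" "\<And>a. a \<in> A \<Longrightarrow> 0 \<le> \<beta> a"
    and mass: "sum \<alpha> A = s" "sum \<beta> A = s"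
    and d: "\<And>a b. a \<in> A \<Longrightarrow> b \<in> A \<Longrightarrow> x a \<le> y b + d"
  shows "(\<Sum>a\<in>A. \<alpha> a * x a) - (\<Sum>a\<in>A. \<beta> a * y a) \<le> s * d"
proof -
  define c where "c = Min (y ` A)"
  have "c \<in> y ` A" unfolding c_def using fin ne by (intro Min_in) auto
  then have "(\<Sum>a\<in>A. \<alpha> a * x a) \<le> (\<Sum>a\<in>A. \<alpha> a * (c + d))"
    using d nonneg by (intro sum_mono mult_left_mono) auto
  also have "\<dots> = s * (c + d)" using mass by (simp flip: sum_distrib_right)
  finally have 1: "(\<Sum>a\<in>A. \<alpha> a * x a) \<le> s * (c + d)" .
  have "s * c = (\<Sum>a\<in>A. \<beta> a * c)" using mass by (simp flip: sum_distrib_right)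
  also have "\<dots> \<le> (\<Sum>a\<in>A. \<beta> a * y a)"
    unfolding c_def using fin nonneg by (intro sum_mono mult_left_mono) auto
  finally show ?thesis using 1 by (simp add: algebra_simps)
qed

text \<open>The Markov chain on words of length \<open>l\<close> that prepends \<open>a\<close> to
  \<open>v\<close> with probability \<open>G (a # v)\<close> and forgets the last letter. In
  \<open>G_ratio\<close> the index of \<open>q\<close> is \<open>Suc k\<close> because
  \<open>a # v\<close> and \<open>a # v'\<close> agree in one letter more than \<open>v\<close> and
  \<open>v'\<close>.\<close>

locale block_chain =
  fixes l :: nat and G :: "'a::finite list \<Rightarrow> real" and q :: "nat \<Rightarrow> real"
  assumes l_pos: "0 < l"
    and G_nonneg: "\<And>v a. length v = l \<Longrightarrow> 0 \<le> G (a # v)"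
    and G_sum: "\<And>v. length v = l \<Longrightarrow> (\<Sum>a\<in>UNIV. G (a # v)) = 1"
    and q_pos: "\<And>k. 0 < q k" and q_le_1: "\<And>k. q k \<le> 1"
    and G_ratio: "\<And>k v v' a. k < l \<Longrightarrow> length v = l \<Longrightarrow> length v' = l \<Longrightarrow> take k v = take k v'
        \<Longrightarrow> q (Suc k) * G (a # v') \<le> G (a # v)"
begin

section \<open>Oscillation under the transfer operator\<close>

definition transfer :: "('a list \<Rightarrow> real) \<Rightarrow> 'a list \<Rightarrow> real" where
  "transfer h v = (\<Sum>a\<in>UNIV. G (a # v) * h (a # butlast v))"

definition agreeing :: "nat \<Rightarrow> ('a list \<times> 'a list) set" where
  "agreeing k = {(v, v'). length v = l \<and> length v' = l \<and> take k v = take k v'}"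

definition osc :: "nat \<Rightarrow> ('a list \<Rightarrow> real) \<Rightarrow> real" where
  "osc k h = Max ((\<lambda>(v, v'). \<bar>h v - h v'\<bar>) ` agreeing k)"

lemma finite_agreeing: "finite (agreeing k)"
  by (rule finite_subset[of _ "{v. length v = l} \<times> {v. length v = l}"]) (auto simp: agreeing_def)

lemma agreeing_nonempty: "agreeing k \<noteq> {}"
proof -
  have "(replicate l undefined, replicate l undefined) \<in> agreeing k" by (simp add: agreeing_def)
  then show ?thesis by blast
qed

lemma abs_diff_le_osc:
  "length v = l \<Longrightarrow> length v' = l \<Longrightarrow> take k v = take k v' \<Longrightarrow> \<bar>h v - h v'\<bar> \<le> osc k h"
  unfolding osc_def using finite_agreeing
  by (intro Max_ge) (auto simp: agreeing_def intro!: image_eqI[of _ _ "(v, v')"])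

lemma osc_leI:
  assumes "\<And>v v'. length v = l \<Longrightarrow> length v' = l \<Longrightarrow> take k v = take k v' \<Longrightarrow> \<bar>h v - h v'\<bar> \<le> c"
  shows "osc k h \<le> c"
  unfolding osc_def using finite_agreeing agreeing_nonempty assms
  by (intro Max.boundedI) (auto simp: agreeing_def)

lemma osc_nonneg: "0 \<le> osc k h"
  using abs_diff_le_osc[of "replicate l undefined" "replicate l undefined" k h] by simp

lemma osc_le_osc_0: "osc k h \<le> osc 0 h"
  by (rule osc_leI) (simp add: abs_diff_le_osc)

lemma osc_block_length [simp]: "osc l h = 0"
  by (rule antisym[OF osc_leI osc_nonneg]) simp

text \<open>Under the maximal coupling of the two one-step transitions, a matching prefix of length
  \<open>k\<close> grows to length \<open>k + 1\<close> with probability at least \<open>q (k + 1)\<close> and is lost otherwise.\<close>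

lemma osc_transfer_le:
  assumes k: "k < l"
  shows "osc k (transfer h) \<le> q (Suc k) * osc (Suc k) h + (1 - q (Suc k)) * osc 0 h"
proof (rule osc_leI)
  have le: "transfer h v - transfer h v' \<le> q (Suc k) * osc (Suc k) h + (1 - q (Suc k)) * osc 0 h"
    if v: "length v = l" "length v' = l" "take k v = take k v'" for v v'
  proof -
    \<comment> \<open>The common part of the two transition laws; its mass \<open>M\<close> is the
      probability that the maximal coupling prepends the same letter to both words.\<close>
    define m where "m a = min (G (a # v)) (G (a # v'))" for a
    define M where "M = (\<Sum>a\<in>UNIV. m a)"
    define x where "x a = h (a # butlast v)" for a
    define y where "y a = h (a # butlast v')" for a
    have len: "length (a # butlast v) = l" "length (b # butlast v') = l" for a b
      using v l_pos by auto
    have pre: "take (Suc k) (a # butlast v) = take (Suc k) (a # butlast v')" for a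
      using v k by (simp add: take_butlast)
    have xy: "x a - y a \<le> osc (Suc k) h" for a
      using abs_diff_le_osc[of "a # butlast v" "a # butlast v'" "Suc k" h] len pre[of a] by (simp add: x_def y_def abs_le_iff)
    have xy0: "x a \<le> y b + osc 0 h" for a b
      using abs_diff_le_osc[of "a # butlast v" "b # butlast v'" 0 h] len by (simp add: x_def y_def abs_le_iff)
    have m_ge: "q (Suc k) * G (a # v') \<le> m a" for a
    proof -
      have "q (Suc k) * G (a # v') \<le> 1 * G (a # v')"
        using q_le_1 G_nonneg v by (intro mult_right_mono) auto
      then show ?thesis unfolding m_def using G_ratio[OF k v] by simp
    qed
    have m_nonneg: "0 \<le> m a" for a using G_nonneg v by (simp add: m_def)
    have "q (Suc k) = (\<Sum>a\<in>UNIV. q (Suc k) * G (a # v'))"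
      using G_sum v by (simp flip: sum_distrib_left)
    also have "\<dots> \<le> M" unfolding M_def by (intro sum_mono m_ge)
    finally have qM: "q (Suc k) \<le> M" .
    \<comment> \<open>The common part compares words that agree in \<open>k + 1\<close> letters. The
      two remainders have equal mass \<open>1 - M\<close> and are bounded by the full
      oscillation.\<close>
    have "transfer h v - transfer h v' = (\<Sum>a\<in>UNIV. m a * (x a - y a))
        + ((\<Sum>a\<in>UNIV. (G (a # v) - m a) * x a) - (\<Sum>a\<in>UNIV. (G (a # v') - m a) * y a))"
      unfolding transfer_def x_def y_def
      by (simp add: algebra_simps sum_subtractf sum.distrib)
    moreover have "(\<Sum>a\<in>UNIV. m a * (x a - y a)) \<le> (\<Sum>a\<in>UNIV. m a * osc (Suc k) h)"
      using xy m_nonneg by (intro sum_mono mult_left_mono) auto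
    moreover have "(\<Sum>a\<in>UNIV. m a * osc (Suc k) h) = M * osc (Suc k) h"
      by (simp add: M_def sum_distrib_right)
    moreover have "(\<Sum>a\<in>UNIV. (G (a # v) - m a) * x a) - (\<Sum>a\<in>UNIV. (G (a # v') - m a) * y a)
        \<le> (1 - M) * osc 0 h"
      using xy0 by (intro weighted_sums_diff_le) (auto simp: m_def M_def sum_subtractf G_sum v)
    \<comment> \<open>Lowering \<open>M\<close> to \<open>q (Suc k)\<close> moves weight onto the
      larger of the two oscillations.\<close>
    moreover have "M * osc (Suc k) h + (1 - M) * osc 0 h
        \<le> q (Suc k) * osc (Suc k) h + (1 - q (Suc k)) * osc 0 h"
      using mult_right_mono[OF qM, of "osc 0 h - osc (Suc k) h"] osc_le_osc_0[of "Suc k" h]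
      by (simp add: algebra_simps)
    ultimately show ?thesis by linarith
  qed
  fix v v' :: "'a list" assume "length v = l" "length v' = l" "take k v = take k v'"
  with le[of v v'] le[of v' v]
  show "\<bar>transfer h v - transfer h v'\<bar> \<le> q (Suc k) * osc (Suc k) h + (1 - q (Suc k)) * osc 0 h"
    by (simp add: abs_le_iff)
qed

definition osc_sum :: "nat \<Rightarrow> ('a list \<Rightarrow> real) \<Rightarrow> nat \<Rightarrow> real" where
  "osc_sum N f k = (\<Sum>j<N. osc k ((transfer ^^ j) f))"

text \<open>The one-step bound is summed over the iterates, the term \<open>j = 0\<close> giving
  \<open>osc k f\<close>. On the right the sums would stop one iterate earlier; nonnegativity lets
  them run to the same \<open>N\<close>, so that the inequality can be iterated in
  \<open>k\<close>.\<close>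

lemma osc_sum_step:
  assumes k: "k < l"
  shows "osc_sum N f k
    \<le> osc k f + q (Suc k) * osc_sum N f (Suc k) + (1 - q (Suc k)) * osc_sum N f 0"
proof (cases N)
  case 0
  then show ?thesis by (simp add: osc_sum_def osc_nonneg)
next
  case (Suc n)
  have mono: "osc_sum n f i \<le> osc_sum N f i" for i
    unfolding osc_sum_def Suc by (simp add: osc_nonneg)
  have "osc_sum N f k = osc k f + (\<Sum>j<n. osc k (transfer ((transfer ^^ j) f)))"
    unfolding osc_sum_def Suc sum.lessThan_Suc_shift by simp
  also have "\<dots> \<le> osc k f + (\<Sum>j<n. q (Suc k) * osc (Suc k) ((transfer ^^ j) f)
      + (1 - q (Suc k)) * osc 0 ((transfer ^^ j) f))"
    by (intro add_left_mono sum_mono osc_transfer_le k)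
  also have "\<dots> = osc k f + (q (Suc k) * osc_sum n f (Suc k) + (1 - q (Suc k)) * osc_sum n f 0)"
    by (simp add: osc_sum_def sum.distrib sum_distrib_left)
  also have "\<dots> \<le> osc k f + (q (Suc k) * osc_sum N f (Suc k) + (1 - q (Suc k)) * osc_sum N f 0)"
    using q_pos[of "Suc k"] q_le_1[of "Suc k"]
    by (intro add_left_mono add_mono mult_left_mono mono) auto
  finally show ?thesis by simp
qed

text \<open>Iterating the recursion from level 0 weights level \<open>k\<close> by
  \<open>Q k\<close>, while the terms \<open>osc i f\<close> keep weight at most 1. At level
  \<open>l\<close> the oscillation vanishes, and moving the finite sum
  \<open>(1 - Q l) * osc_sum N f 0\<close> to the left leaves the factor \<open>Q l\<close>.\<close>

lemma osc_sum_le: "(\<Prod>i=1..l. q i) * osc_sum N f 0 \<le> (\<Sum>i<l. osc i f)"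
proof -
  define Q where "Q k = (\<Prod>i=1..k. q i)" for k
  have Q: "0 \<le> Q k" "Q k \<le> 1" "Q (Suc k) = Q k * q (Suc k)" for k
    unfolding Q_def using q_pos q_le_1 less_imp_le[OF q_pos]
    by (auto intro!: prod_nonneg prod_le_1)
  have "k \<le> l \<Longrightarrow> osc_sum N f 0 \<le> (\<Sum>i<k. osc i f) + Q k * osc_sum N f k + (1 - Q k) * osc_sum N f 0" for k
  proof (induction k)
    case 0
    then show ?case by (simp add: Q_def)
  next
    case (Suc k)
    have "Q k * osc_sum N f k
        \<le> Q k * (osc k f + q (Suc k) * osc_sum N f (Suc k) + (1 - q (Suc k)) * osc_sum N f 0)"
      using Suc Q by (intro mult_left_mono osc_sum_step) auto
    moreover have "Q k * osc k f \<le> 1 * osc k f"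
      using Q osc_nonneg by (intro mult_right_mono) auto
    ultimately show ?case using Suc Q(3)[of k] by (simp add: algebra_simps)
  qed
  from this[of l] have "Q l * osc_sum N f 0 \<le> (\<Sum>i<l. osc i f)"
    by (simp add: osc_sum_def algebra_simps)
  then show ?thesis by (simp add: Q_def)
qed

section \<open>Means under exact and approximate stationary laws\<close>

definition mean :: "('a list \<Rightarrow> real) \<Rightarrow> ('a list \<Rightarrow> real) \<Rightarrow> real" where
  "mean p h = (\<Sum>v | length v = l. p v * h v)"

text \<open>The difference of the means is \<open>h\<close> integrated against the defect
  \<open>p (a # v) - G (a # v) * p v\<close>. For each \<open>v\<close> the defect sums to zero over
  \<open>a\<close>, so the oscillation of \<open>h\<close> controls the integral and its size does
  not enter.\<close>

lemma mean_transfer_le: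
  assumes p: "cyl_law p"
    and near: "\<And>a v. length v = l \<Longrightarrow> \<bar>p (a # v) - G (a # v) * p v\<bar> \<le> \<eta> * (G (a # v) * p v)"
  shows "\<bar>mean p h - mean p (transfer h)\<bar> \<le> \<eta> * osc 0 h"
proof -
  \<comment> \<open>Appending a letter gives a sum over words of length \<open>l + 1\<close>, which
    is then regrouped by first letter to match \<open>transfer\<close>.\<close>
  have "mean p h = (\<Sum>v | length v = l. \<Sum>b\<in>UNIV. p (v @ [b]) * h v)"
    unfolding mean_def using cyl_law_snoc[OF p]
    by (intro sum.cong refl) (simp flip: sum_distrib_right)
  also have "\<dots> = (\<Sum>u | length u = Suc l. p u * h (butlast u))"
    unfolding sum_words_snoc by simp
  also have "\<dots> = (\<Sum>v | length v = l. \<Sum>a\<in>UNIV. p (a # v) * h (butlast (a # v)))"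
    unfolding sum_words_Cons ..
  also have "\<dots> = (\<Sum>v | length v = l. \<Sum>a\<in>UNIV. p (a # v) * h (a # butlast v))"
    using l_pos by (intro sum.cong refl) auto
  finally have "mean p h - mean p (transfer h) =
      (\<Sum>v | length v = l. \<Sum>a\<in>UNIV. (p (a # v) - G (a # v) * p v) * h (a # butlast v))"
    unfolding mean_def transfer_def
    by (simp add: sum_subtractf sum_distrib_left algebra_simps)
  also have "\<bar>\<dots>\<bar> \<le> (\<Sum>v | length v = l. \<eta> * osc 0 h * p v)"
  proof (rule order_trans[OF sum_abs sum_mono])
    fix v :: "'a list" assume "v \<in> {v. length v = l}"
    then have v: "length v = l" by simp
    \<comment> \<open>Since the defect has zero sum, \<open>h\<close> may be centred at any value it
      takes over \<open>v\<close>.\<close>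
    define c where "c = h (undefined # butlast v)"
    have "(\<Sum>a\<in>UNIV. p (a # v) - G (a # v) * p v) = 0"
      using cyl_law_Cons[OF p, of v] G_sum[OF v] by (simp add: sum_subtractf flip: sum_distrib_right)
    then have "(\<Sum>a\<in>UNIV. (p (a # v) - G (a # v) * p v) * h (a # butlast v))
        = (\<Sum>a\<in>UNIV. (p (a # v) - G (a # v) * p v) * (h (a # butlast v) - c))"
      by (simp add: right_diff_distrib sum_subtractf[of _ "\<lambda>a. _ a * c"] flip: sum_distrib_right)
    also have "\<bar>\<dots>\<bar> \<le> (\<Sum>a\<in>UNIV. \<eta> * (G (a # v) * p v) * osc 0 h)"
    proof (rule order_trans[OF sum_abs sum_mono])
      fix a
      have "\<bar>h (a # butlast v) - c\<bar> \<le> osc 0 h"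
        unfolding c_def using v l_pos by (intro abs_diff_le_osc) auto
      then show "\<bar>(p (a # v) - G (a # v) * p v) * (h (a # butlast v) - c)\<bar>
          \<le> \<eta> * (G (a # v) * p v) * osc 0 h"
        unfolding abs_mult using near[OF v, of a] by (intro mult_mono) auto
    qed
    also have "\<dots> = (\<Sum>a\<in>UNIV. G (a # v)) * (\<eta> * osc 0 h * p v)"
      unfolding sum_distrib_right by (intro sum.cong refl) simp
    finally show "\<bar>\<Sum>a\<in>UNIV. (p (a # v) - G (a # v) * p v) * h (a # butlast v)\<bar>
        \<le> \<eta> * osc 0 h * p v"
      using G_sum[OF v] by simp
  qed
  also have "\<dots> = \<eta> * osc 0 h"
    using cyl_law_sum_words[OF p, of l] by (simp flip: sum_distrib_left)
  finally show ?thesis .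
qed

lemma mean_funpow_transfer_le:
  assumes "cyl_law p"
    and "\<And>a v. length v = l \<Longrightarrow> \<bar>p (a # v) - G (a # v) * p v\<bar> \<le> \<eta> * (G (a # v) * p v)"
  shows "\<bar>mean p f - mean p ((transfer ^^ N) f)\<bar> \<le> \<eta> * osc_sum N f 0"
proof (induction N)
  case (Suc N)
  then show ?case
    using mean_transfer_le[OF assms, of "(transfer ^^ N) f"]
    by (simp add: osc_sum_def distrib_left)
qed (simp add: osc_sum_def)

lemma mean_diff_le:
  assumes "cyl_law p" "cyl_law p'"
  shows "\<bar>mean p h - mean p' h\<bar> \<le> osc 0 h"
proof -
  have "mean p h - mean p' h \<le> 1 * osc 0 h" if p: "cyl_law p" "cyl_law p'" for p p'
    unfolding mean_def
  proof (rule weighted_sums_diff_le)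
    show "{v :: 'a list. length v = l} \<noteq> {}" by (auto intro: exI[of _ "replicate l undefined"])
    show "h a \<le> h b + osc 0 h" if "a \<in> {v. length v = l}" "b \<in> {v. length v = l}" for a b
      using abs_diff_le_osc[of a b 0 h] that by auto
  qed (use p in \<open>auto simp: cyl_law_sum_words cyl_law_pos less_imp_le\<close>)
  from this[OF assms] this[OF assms(2,1)] show ?thesis by (simp add: abs_le_iff)
qed

text \<open>Applying \<open>transfer\<close> \<open>N\<close> times to the indicator
  \<open>f\<close> of the cylinder leaves its mean under \<open>p\<close> unchanged and moves the
  mean under \<open>p'\<close> by at most \<open>\<eta> * osc_sum N f 0\<close>. Afterwards the two
  means differ by at most the oscillation of the \<open>N\<close>-th iterate, which tends to
  zero.\<close>

theorem cyl_law_perturbation: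
  assumes p: "cyl_law p" and p': "cyl_law p'"
    and stat: "\<And>a v. length v = l \<Longrightarrow> p (a # v) = G (a # v) * p v"
    and near: "\<And>a v. length v = l \<Longrightarrow> \<bar>p' (a # v) - G (a # v) * p' v\<bar> \<le> \<eta> * (G (a # v) * p' v)"
    and \<eta>: "0 \<le> \<eta>" and w: "length w \<le> l"
  shows "\<bar>p' w - p w\<bar> \<le> \<eta> * real (length w) / (\<Prod>i=1..l. q i)"
proof -
  define f :: "'a list \<Rightarrow> real" where "f v = of_bool (take (length w) v = w)" for v
  define Q where "Q = (\<Prod>i=1..l. q i)"
  have Q: "0 < Q" unfolding Q_def using q_pos by (intro prod_pos) auto
  have mean_f: "mean r f = r w" if "cyl_law r" for r
  proof -
    have split: "w @ drop (length w) v = v" if "take (length w) v = w" for v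
      using append_take_drop_id[of "length w" v] that by simp
    have "mean r f = (\<Sum>v | length v = l \<and> take (length w) v = w. r v)"
      unfolding mean_def f_def by (rule sum.mono_neutral_cong_right) auto
    also have "\<dots> = (\<Sum>u | length u = l - length w. r (w @ u))"
      by (rule sum.reindex_bij_witness[of _ "\<lambda>u. w @ u" "drop (length w)"])
         (use w split in auto)
    finally show ?thesis using cyl_law_sum_append[OF that, of w "l - length w"] by simp
  qed
  \<comment> \<open>The indicator reads only the first \<open>length w\<close> letters, so only that
    many oscillations can be nonzero, each at most 1. This is the origin of the factor
    \<open>length w\<close>.\<close>
  have "(\<Sum>i<l. osc i f) \<le> (\<Sum>i<l. of_bool (i < length w))"
  proof (rule sum_mono)
    fix i
    show "osc i f \<le> of_bool (i < length w)"
    proof (rule osc_leI)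
      fix v v' :: "'a list" assume *: "take i v = take i v'"
      show "\<bar>f v - f v'\<bar> \<le> of_bool (i < length w)"
      proof (cases "i < length w")
        case False
        then have "take (length w) v = take (length w) v'"
          using arg_cong[OF *, of "take (length w)"] by (simp add: min_def)
        then show ?thesis by (simp add: f_def)
      qed (simp add: f_def)
    qed
  qed
  also have "\<dots> = real (length w)"
  proof -
    have "(\<Sum>i<l. of_bool (i < length w)) = (\<Sum>i<length w. 1 :: real)"
      by (rule sum.mono_neutral_cong_right) (use w in auto)
    then show ?thesis by simp
  qed
  finally have osc_f: "(\<Sum>i<l. osc i f) \<le> real (length w)" .
  have bound: "osc_sum N f 0 \<le> real (length w) / Q" for N
    using osc_sum_le[of N f] osc_f Q by (simp add: Q_def field_simps)
  have main: "\<bar>p' w - p w\<bar> - \<eta> * (real (length w) / Q) \<le> osc 0 ((transfer ^^ N) f)" for N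
  proof -
    have "\<bar>mean p f - mean p ((transfer ^^ N) f)\<bar> \<le> 0 * osc_sum N f 0"
      using stat by (intro mean_funpow_transfer_le p) simp
    moreover have "\<bar>mean p' f - mean p' ((transfer ^^ N) f)\<bar> \<le> \<eta> * osc_sum N f 0"
      by (intro mean_funpow_transfer_le p' near)
    moreover have "\<eta> * osc_sum N f 0 \<le> \<eta> * (real (length w) / Q)"
      using bound \<eta> by (intro mult_left_mono)
    moreover have "\<bar>mean p' ((transfer ^^ N) f) - mean p ((transfer ^^ N) f)\<bar> \<le> osc 0 ((transfer ^^ N) f)"
      by (rule mean_diff_le[OF p' p])
    ultimately show ?thesis using mean_f[OF p] mean_f[OF p'] by linarith
  qed
  \<comment> \<open>The bound on \<open>osc_sum\<close> is uniform in \<open>N\<close>, so it also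
    supplies the mixing of the chain.\<close>
  have "summable (\<lambda>N. osc 0 ((transfer ^^ N) f))"
    using bound by (intro summableI_nonneg_bounded[where x = "real (length w) / Q"])
      (auto simp: osc_sum_def osc_nonneg)
  then have "(\<lambda>N. osc 0 ((transfer ^^ N) f)) \<longlonglongrightarrow> 0" by (rule summable_LIMSEQ_zero)
  then have "\<bar>p' w - p w\<bar> - \<eta> * (real (length w) / Q) \<le> 0"
    by (rule LIMSEQ_le_const) (use main in blast)
  then show ?thesis by (simp add: Q_def)
qed

end

section \<open>The shift-invariant measure with given cylinder probabilities\<close>

text \<open>The conditional law of letter \<open>n\<close> given the letters before it. The kernels
  append letters at the end, as the extension theorem requires, whereas a g-function governs the
  first letter given the later ones.\<close>

definition next_letter :: "('a::finite list \<Rightarrow> real) \<Rightarrow> nat \<Rightarrow> (nat \<Rightarrow> 'a) \<Rightarrow> 'a measure" where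
  "next_letter p n \<omega> = point_measure UNIV (\<lambda>a. ennreal (p (map \<omega> [0..<n] @ [a]) / p (map \<omega> [0..<n])))"

lemma Ionescu_Tulcea_next_letter:
  fixes p :: "'a::finite list \<Rightarrow> real"
  assumes p: "cyl_law p"
  shows "Ionescu_Tulcea (next_letter p) (\<lambda>_. count_space UNIV)"
proof (rule Ionescu_Tulcea.intro)
  have prob: "prob_space (next_letter p n \<omega>)" for n and \<omega> :: "nat \<Rightarrow> 'a"
  proof
    have "(\<Sum>a\<in>UNIV. p (map \<omega> [0..<n] @ [a]) / p (map \<omega> [0..<n])) = 1"
      using cyl_law_snoc[OF p, of "map \<omega> [0..<n]"] cyl_law_pos[OF p, of "map \<omega> [0..<n]"]
      by (simp flip: sum_divide_distrib)
    then show "emeasure (next_letter p n \<omega>) (space (next_letter p n \<omega>)) = 1"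
      using less_imp_le[OF cyl_law_pos[OF p]]
      by (simp add: next_letter_def emeasure_point_measure_finite space_point_measure sum_ennreal)
  qed
  show "prob_space (next_letter p n \<omega>)" for n and \<omega> :: "nat \<Rightarrow> 'a" by (rule prob)
  have "next_letter p n \<omega> \<in> space (subprob_algebra (count_space UNIV))" for n and \<omega> :: "nat \<Rightarrow> 'a"
    using prob[of n \<omega>]
    by (auto simp: space_subprob_algebra prob_space_imp_subprob_space next_letter_def sets_point_measure)
  then show "next_letter p n \<in> measurable (PiM {0..<n} (\<lambda>_. count_space UNIV)) (subprob_algebra (count_space UNIV))" for n
    by (subst count_space_PiM_finite) (auto simp: measurable_count_space_eq1)
qed

text \<open>The Ionescu-Tulcea theorem extends the kernels, whose products telescope to
  \<open>p\<close> on prefixes. Invariance is checked on cylinders, where it is the sum rule for the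
  first letter.\<close>

lemma measure_of_cyl_law:
  fixes p :: "'a::finite list \<Rightarrow> real"
  assumes p: "cyl_law p"
  obtains \<mu> :: "(nat \<Rightarrow> 'a) measure"
  where "Mplus \<mu>" "\<And>A. A \<in> sets \<mu> \<Longrightarrow> emeasure \<mu> (shiftT -` A) = emeasure \<mu> A"
    "\<And>w. measure \<mu> (cyl w) = p w"
proof -
  interpret IT: Ionescu_Tulcea "next_letter p" "\<lambda>_. count_space UNIV"
    by (rule Ionescu_Tulcea_next_letter[OF p])
  define C where "C n = IT.C 0 n (\<lambda>_. undefined)" for n
  \<comment> \<open>The point of the finite product space that spells \<open>v\<close>; such points
    are undefined outside the index set.\<close>
  define seq where "seq v = restrict (\<lambda>i. v ! i) {0..<length v}" for v :: "'a list"
  have space_n [simp]: "space (PiM {0..<n} (\<lambda>_. count_space (UNIV :: 'a set))) = PiE {0..<n} (\<lambda>_. UNIV)" for n :: nat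
    by (simp add: space_PiM)
  have sets_n: "A \<in> sets (PiM {0..<n} (\<lambda>_. count_space (UNIV :: 'a set)))"
    if "A \<subseteq> PiE {0..<n} (\<lambda>_. UNIV)" for n :: nat and A
    using that by (subst count_space_PiM_finite) auto
  have seq_in: "seq v \<in> PiE {0..<length v} (\<lambda>_. UNIV)" for v by (auto simp: seq_def)
  have undef: "(\<lambda>_. undefined) \<in> space (PiM {0..<(0::nat)} (\<lambda>_. count_space (UNIV :: 'a set)))"
    by (simp add: space_PiM)
  have sets_C: "sets (C n) = sets (PiM {0..<n} (\<lambda>_. count_space UNIV))"
    and space_C: "space (C n) = PiE {0..<n} (\<lambda>_. UNIV)" for n
    using IT.sets_C[OF undef, of n] IT.space_C[OF undef, of n] by (simp_all add: C_def)
  have C_seq: "emeasure (C (length v)) {seq v} = p v" for v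
  proof (induction v rule: rev_induct)
    case Nil
    show ?case
      by (simp add: C_def seq_def cyl_law_Nil[OF p] restrict_def emeasure_return sets_PiM_empty)
  next
    case (snoc a v)
    let ?n = "length v"
    have kernel: "emeasure (IT.eP ?n \<omega>) {seq (v @ [a])}
        = ennreal (p (v @ [a]) / p v) * indicator {seq v} \<omega>"
      if \<omega>: "\<omega> \<in> PiE {0..<?n} (\<lambda>_. UNIV)" for \<omega>
    proof -
      have eq: "fun_upd \<omega> ?n b = seq (v @ [a]) \<longleftrightarrow> \<omega> = seq v \<and> b = a" for b
      proof
        assume *: "fun_upd \<omega> ?n b = seq (v @ [a])"
        have "\<omega> i = seq v i" for i
          using fun_cong[OF *, of i] \<omega> by (auto simp: seq_def nth_append PiE_iff extensional_def split: if_splits)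
        moreover have "b = a" using fun_cong[OF *, of ?n] by (simp add: seq_def)
        ultimately show "\<omega> = seq v \<and> b = a" by blast
      qed (auto simp: seq_def nth_append fun_eq_iff)
      have "emeasure (IT.eP ?n \<omega>) {seq (v @ [a])} = emeasure (next_letter p ?n \<omega>) {b. fun_upd \<omega> ?n b = seq (v @ [a])}"
        using \<omega> sets_n[of "{seq (v @ [a])}" "Suc ?n"] seq_in[of "v @ [a]"]
        by (subst IT.emeasure_eP) (auto simp: vimage_def)
      also have "\<dots> = ennreal (p (v @ [a]) / p v) * indicator {seq v} \<omega>"
      proof (cases "\<omega> = seq v")
        case True
        have "map (seq v) [0..<?n] = v" by (auto simp: seq_def intro!: nth_equalityI)
        moreover have "{b. fun_upd \<omega> ?n b = seq (v @ [a])} = {a}" using eq True by auto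
        ultimately show ?thesis
          using True by (simp add: next_letter_def emeasure_point_measure_finite)
      qed (simp add: eq)
      finally show ?thesis .
    qed
    have "emeasure (C (length (v @ [a]))) {seq (v @ [a])} = emeasure (C ?n \<bind> IT.eP ?n) {seq (v @ [a])}"
      by (simp add: C_def)
    also have "\<dots> = (\<integral>\<^sup>+\<omega>. emeasure (IT.eP ?n \<omega>) {seq (v @ [a])} \<partial>C ?n)"
    proof (rule emeasure_bind)
      show "space (C ?n) \<noteq> {}" by (simp add: space_C PiE_eq_empty_iff)
      show "IT.eP ?n \<in> measurable (C ?n) (subprob_algebra (PiM {0..<Suc ?n} (\<lambda>_. count_space UNIV)))"
        using IT.measurable_eP[of ?n] by (subst measurable_cong_sets[OF sets_C refl])
      show "{seq (v @ [a])} \<in> sets (PiM {0..<Suc ?n} (\<lambda>_. count_space UNIV))"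
        using seq_in[of "v @ [a]"] by (intro sets_n) simp
    qed
    also have "\<dots> = (\<integral>\<^sup>+\<omega>. ennreal (p (v @ [a]) / p v) * indicator {seq v} \<omega> \<partial>C ?n)"
      by (rule nn_integral_cong) (simp add: space_C kernel)
    also have "\<dots> = ennreal (p (v @ [a]) / p v) * emeasure (C ?n) {seq v}"
      using sets_n[of "{seq v}" ?n] seq_in[of v]
      by (intro nn_integral_cmult_indicator) (simp add: sets_C)
    also have "\<dots> = ennreal (p (v @ [a]))"
      using snoc less_imp_le[OF cyl_law_pos[OF p]] less_imp_neq[OF cyl_law_pos[OF p, of v]]
      by (simp flip: ennreal_mult)
    finally show ?case .
  qed
  have emb: "IT.PF.emb UNIV {0..<length v} {seq v} = cyl v" for v
  proof -
    have "restrict x {0..<length v} = seq v \<longleftrightarrow> x \<in> cyl v" for x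
    proof
      assume *: "restrict x {0..<length v} = seq v"
      have "x i = v ! i" if "i < length v" for i
        using fun_cong[OF *, of i] that by (simp add: seq_def)
      then show "x \<in> cyl v" by (simp add: cyl_def)
    qed (auto simp: seq_def cyl_def)
    then show ?thesis unfolding prod_emb_def by (intro set_eqI) simp
  qed
  have sing: "{seq v} \<in> sets (PiM {0..<length v} (\<lambda>_. count_space UNIV))" for v
    using seq_in by (intro sets_n) simp
  have cyl_sets: "cyl v \<in> sets IT.PF.lim" for v
    unfolding emb[symmetric] using sing[of v] by (simp add: sets_PiM_I_finite measurable_prod_emb)
  have lim: "emeasure IT.PF.lim (cyl v) = p v" for v
  proof -
    have "emeasure IT.PF.lim (cyl v) = emeasure (IT.CI {0..<length v}) {seq v}"
      unfolding emb[symmetric] by (rule IT.lim[OF _ sing]) simp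
    also have "\<dots> = emeasure (C (length v)) (IT.PF.emb {0..<length v} {0..<length v} {seq v})"
      unfolding C_def by (rule IT.emeasure_CI[OF _ sing]) simp
    also have "IT.PF.emb {0..<length v} {0..<length v} {seq v} = {seq v}"
      using seq_in[of v] by (intro prod_emb_id) auto
    finally show ?thesis by (simp add: C_seq)
  qed
  have space_lim: "space IT.PF.lim = UNIV" by (simp add: space_PiM)
  \<comment> \<open>The limit measure lives on the product sigma-algebra; the identity carries it to
    \<open>borelX\<close>, which is generated by cylinders.\<close>
  have id_meas: "(\<lambda>x. x) \<in> measurable IT.PF.lim borelX"
    by (rule measurable_sigma_sets[OF sets_borelX]) (use cyl_sets space_lim in auto)
  define \<mu> where "\<mu> = distr IT.PF.lim borelX (\<lambda>x. x)"
  have sets_\<mu>: "sets \<mu> = sets borelX" and space_\<mu>: "space \<mu> = UNIV" by (simp_all add: \<mu>_def)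
  have em: "emeasure \<mu> (cyl v) = p v" for v
    using emeasure_distr[OF id_meas cyl_in_borelX, of v] lim[of v] space_lim by (simp only: \<mu>_def vimage_ident Int_UNIV_right)
  have me: "measure \<mu> (cyl v) = p v" for v
    using less_imp_le[OF cyl_law_pos[OF p]] by (simp add: measure_def em)
  interpret prob_space \<mu>
    using em[of "[]"] cyl_law_Nil[OF p] by (intro prob_spaceI) (simp add: space_\<mu>)
  have M: "Mplus \<mu>"
    using cyl_law_pos[OF p] by (simp add: Mplus_def me sets_\<mu> space_\<mu> prob_space_axioms)
  have meas: "shiftT \<in> measurable \<mu> borelX"
    using measurable_shiftT measurable_cong_sets[OF sets_\<mu> refl] by blast
  have "distr \<mu> borelX shiftT = \<mu>"
  proof (rule measure_eqI_cyl)
    show "prob_space (distr \<mu> borelX shiftT)" using meas by (rule prob_space_distr)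
    fix w :: "'a list"
    have "measure (distr \<mu> borelX shiftT) (cyl w) = measure \<mu> (\<Union>a. cyl (a # w))"
      using meas by (simp add: measure_distr space_\<mu> shiftT_vimage_cyl)
    also have "\<dots> = (\<Sum>a\<in>UNIV. measure \<mu> (cyl (a # w)))"
      by (rule finite_measure_finite_Union)
        (simp, simp add: image_subset_iff sets_\<mu>, auto simp: disjoint_family_on_def cyl_Cons)
    finally show "measure (distr \<mu> borelX shiftT) (cyl w) = measure \<mu> (cyl w)"
      by (simp add: me cyl_law_Cons[OF p])
  qed (simp_all add: sets_\<mu> prob_space_axioms)
  then have "emeasure \<mu> (shiftT -` A) = emeasure \<mu> A" if "A \<in> sets \<mu>" for A
    using emeasure_distr[OF meas, of A] that by (simp add: sets_\<mu> space_\<mu>)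
  with M me show thesis using that by blast
qed

section \<open>Compatible measures\<close>

lemma compatible_cyl_law:
  "compatible_g_measure g \<mu> \<Longrightarrow> cyl_law (\<lambda>w. measure \<mu> (cyl w))"
  unfolding compatible_g_measure_def by (intro cyl_law_measure) auto

text \<open>A choice function for the next letter is iterated; letters already written never change,
  so the words converge to a sequence.\<close>

lemma infinite_word_extension:
  assumes w: "P w" and step: "\<And>u. P u \<Longrightarrow> \<exists>b. P (u @ [b])"
  obtains y where "map y [0..<length w] = w" "\<And>n. length w \<le> n \<Longrightarrow> P (map y [0..<n])"
proof -
  obtain nxt where nxt: "\<And>u. P u \<Longrightarrow> P (u @ [nxt u])" using step by metis
  define W where "W = rec_nat w (\<lambda>_ u. u @ [nxt u])"
  have W: "W 0 = w" "W (Suc n) = W n @ [nxt (W n)]" for n by (simp_all add: W_def)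
  have P: "P (W n)" for n by (induction n) (simp_all add: W w nxt)
  have len: "length (W n) = length w + n" for n by (induction n) (simp_all add: W)
  have stable: "W (n + k) ! i = W n ! i" if "i < length w + n" for n k i
    using that by (induction k) (simp_all add: W nth_append len)
  \<comment> \<open>\<open>W (Suc i)\<close> has more than \<open>i\<close> letters whatever the
    length of \<open>w\<close>, even if \<open>w\<close> is empty.\<close>
  define y where "y i = W (Suc i) ! i" for i
  have W_y: "map y [0..<length w + n] = W n" for n
  proof (rule nth_equalityI)
    fix i assume "i < length (map y [0..<length w + n])"
    then show "map y [0..<length w + n] ! i = W n ! i"
      using stable[of i n "Suc i"] stable[of i "Suc i" n] by (simp add: y_def add.commute)
  qed (simp add: len)
  show thesis
  proof (rule that)
    show "map y [0..<length w] = w" using W_y[of 0] W by simp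
    show "P (map y [0..<n])" if "length w \<le> n" for n
      using W_y[of "n - length w"] P[of "n - length w"] that by simp
  qed
qed

lemma word_case_nat: "word (case_nat a y) 0 (Suc n) = a # map y [0..<n]"
  "word (case_nat a y) 1 (Suc n) = map y [0..<n]"
  unfolding word_def by (simp_all add: upt_conv_Cons map_Suc_upt[symmetric] del: upt_Suc)

text \<open>\<open>p (a # w) / p w\<close> is a weighted average of the ratios for the words extending \<open>w\<close>, so
  letters can be appended one at a time without letting the ratio decrease (\<open>s = 1\<close>) or
  increase (\<open>s = -1\<close>).\<close>

lemma g_value_beyond_ratio:
  fixes p :: "'a::finite list \<Rightarrow> real" and s :: real
  assumes p: "cyl_law p"
    and g: "\<And>x. (\<lambda>n. p (word x 0 n) / p (word x 1 n)) \<longlonglongrightarrow> g x"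
  obtains x where "x \<in> cyl (a # w)" "s * (p (a # w) / p w) \<le> s * g x"
proof -
  define c where "c = p (a # w) / p w"
  \<comment> \<open>With the denominator cleared, the comparison of \<open>p (a # u) / p u\<close>
    with \<open>c\<close> is additive over one-letter extensions of \<open>u\<close>; hence it
    cannot fail for all of them if it holds for \<open>u\<close>.\<close>
  define P where "P u \<longleftrightarrow> 0 \<le> s * (p (a # u) - c * p u)" for u
  have "P w" using cyl_law_pos[OF p, of w] by (simp add: P_def c_def)
  moreover have "\<exists>b. P (u @ [b])" if "P u" for u
  proof (rule ccontr)
    assume "\<nexists>b. P (u @ [b])"
    then have "(\<Sum>b\<in>UNIV. s * (p (a # u @ [b]) - c * p (u @ [b]))) < (\<Sum>b\<in>(UNIV :: 'a set). 0)"
      by (intro sum_strict_mono) (auto simp: P_def not_le)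
    moreover have "(\<Sum>b\<in>UNIV. s * (p (a # u @ [b]) - c * p (u @ [b]))) = s * (p (a # u) - c * p u)"
      using cyl_law_snoc[OF p, of "a # u"] cyl_law_snoc[OF p, of u]
      by (simp add: sum_subtractf flip: sum_distrib_left)
    ultimately show False using that by (simp add: P_def)
  qed
  ultimately obtain y where y: "map y [0..<length w] = w" "\<And>n. length w \<le> n \<Longrightarrow> P (map y [0..<n])"
    using infinite_word_extension[of P w] by metis
  define x where "x = case_nat a y"
  have "s * c \<le> s * (p (word x 0 n) / p (word x 1 n))" if n: "n \<ge> Suc (length w)" for n
  proof -
    obtain m where m: "n = Suc m" "length w \<le> m" using n by (cases n) auto
    have "0 \<le> s * (p (word x 0 n) - c * p (word x 1 n)) / p (word x 1 n)"
      using y(2)[OF m(2)] less_imp_le[OF cyl_law_pos[OF p, of "word x 1 n"]]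
      unfolding x_def m word_case_nat P_def by (intro divide_nonneg_nonneg)
    then show ?thesis
      using cyl_law_pos[OF p, of "word x 1 n"] by (simp add: field_simps)
  qed
  then have "s * c \<le> s * g x"
    by (intro LIMSEQ_le_const[OF tendsto_mult[OF tendsto_const g]]) blast
  moreover have "y i = w ! i" if "i < length w" for i
    using arg_cong[OF y(1), of "\<lambda>v. v ! i"] that by simp
  then have "x \<in> cyl (a # w)"
    by (auto simp: cyl_def x_def less_Suc_eq_0_disj)
  ultimately show thesis using that by (simp add: c_def)
qed

text \<open>Compatibility describes \<open>g\<close> only through a limit along longer words. As
  some point of the cylinder has a \<open>g\<close>-value beyond the ratio in the chosen direction,
  bounds on \<open>g\<close> become exact bounds at finite length.\<close>

lemma
  assumes g: "compatible_g_measure g \<mu>"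
  shows compatible_ratio_le: "(\<And>x. x \<in> cyl (a # w) \<Longrightarrow> g x \<le> B)
      \<Longrightarrow> measure \<mu> (cyl (a # w)) \<le> B * measure \<mu> (cyl w)"
    and compatible_ratio_ge: "(\<And>x. x \<in> cyl (a # w) \<Longrightarrow> A \<le> g x)
      \<Longrightarrow> A * measure \<mu> (cyl w) \<le> measure \<mu> (cyl (a # w))"
proof -
  define p where "p w = measure \<mu> (cyl w)" for w
  have p: "cyl_law p" using compatible_cyl_law[OF g] by (simp add: p_def[abs_def])
  have lim: "(\<lambda>n. p (word x 0 n) / p (word x 1 n)) \<longlonglongrightarrow> g x" for x
    using g by (simp add: compatible_g_measure_def p_def)
  have pos: "0 < p w" using cyl_law_pos[OF p] .
  show "measure \<mu> (cyl (a # w)) \<le> B * measure \<mu> (cyl w)" if "\<And>x. x \<in> cyl (a # w) \<Longrightarrow> g x \<le> B"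
  proof -
    obtain x where "x \<in> cyl (a # w)" "1 * (p (a # w) / p w) \<le> 1 * g x"
      by (rule g_value_beyond_ratio[OF p lim])
    then have "p (a # w) / p w \<le> B" using that[of x] by simp
    then show ?thesis using pos by (simp add: p_def field_simps)
  qed
  show "A * measure \<mu> (cyl w) \<le> measure \<mu> (cyl (a # w))" if "\<And>x. x \<in> cyl (a # w) \<Longrightarrow> A \<le> g x"
  proof -
    obtain x where "x \<in> cyl (a # w)" "- 1 * (p (a # w) / p w) \<le> - 1 * g x"
      by (rule g_value_beyond_ratio[OF p lim])
    then have "A \<le> p (a # w) / p w" using that[of x] by simp
    then show ?thesis using pos by (simp add: p_def field_simps)
  qed
qed

section \<open>Variation of continuous functions\<close>

lemma continuous_map_ln_g_function:
  assumes "g_function g"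
  shows "continuous_map Xtop euclideanreal (\<lambda>x. ln (g x))"
proof -
  have "continuous_map Xtop (top_of_set {0<..}) g"
    using assms by (simp add: g_function_def continuous_map_in_subtopology image_subset_iff)
  moreover have "continuous_map (top_of_set {0<..}) euclideanreal (ln :: real \<Rightarrow> real)"
    by (auto intro!: continuous_intros)
  ultimately show ?thesis
    using continuous_map_compose[of Xtop "top_of_set {0<..}" g euclideanreal ln] by (simp add: o_def)
qed

lemma abs_diff_le_var:
  fixes h :: "(nat \<Rightarrow> 'a::finite) \<Rightarrow> real"
  assumes B: "\<And>x. \<bar>h x\<bar> \<le> B" and xy: "x \<in> cyl u" "y \<in> cyl u"
  shows "\<bar>h x - h y\<bar> \<le> var (length u) h"
proof -
  have "bdd_above (h ` cyl u)" using B by (intro bdd_aboveI2[of _ _ B]) (metis abs_le_iff)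
  moreover have "bdd_below (h ` cyl u)" using B by (intro bdd_belowI2[of _ "- B"]) (metis abs_le_iff minus_le_iff)
  ultimately have "\<bar>h x - h y\<bar> \<le> (SUP x\<in>cyl u. h x) - (INF x\<in>cyl u. h x)"
    using cSUP_upper[of x "cyl u" h] cSUP_upper[of y "cyl u" h]
      cINF_lower[of h "cyl u" x] cINF_lower[of h "cyl u" y] xy by linarith
  also have "\<dots> \<le> var (length u) h" unfolding var_def by (intro Max_ge) auto
  finally show ?thesis .
qed

lemma var_leI:
  fixes h :: "(nat \<Rightarrow> 'a::finite) \<Rightarrow> real"
  assumes "\<And>x y. (\<forall>i<k. x i = y i) \<Longrightarrow> \<bar>h x - h y\<bar> \<le> c"
  shows "var k h \<le> c"
proof -
  have "(SUP x\<in>cyl w. h x) - (INF x\<in>cyl w. h x) \<le> c" if w: "length w = k" for w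
  proof -
    have "h x - c \<le> h y" if "x \<in> cyl w" "y \<in> cyl w" for x y
      using assms[of x y] that w by (auto simp: cyl_def abs_le_iff)
    then have "h x - c \<le> (INF y\<in>cyl w. h y)" if "x \<in> cyl w" for x
      using that cyl_nonempty by (intro cINF_greatest)
    then have "(SUP x\<in>cyl w. h x) \<le> (INF y\<in>cyl w. h y) + c"
      using cyl_nonempty by (intro cSUP_least) (auto simp: diff_le_eq)
    then show ?thesis by simp
  qed
  moreover have "{w :: 'a list. length w = k} \<noteq> {}"
    by (auto intro: exI[of _ "replicate k undefined"])
  ultimately show ?thesis unfolding var_def by (intro Max.boundedI) auto
qed

lemma var_nonneg:
  fixes h :: "(nat \<Rightarrow> 'a::finite) \<Rightarrow> real"
  assumes "\<And>x. \<bar>h x\<bar> \<le> B"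
  shows "0 \<le> var k h"
proof -
  have "(\<lambda>_. undefined) \<in> cyl (replicate k undefined)" by (simp add: cyl_def)
  with abs_diff_le_var[OF assms this this] show ?thesis by simp
qed

lemma var_tendsto_0:
  fixes h :: "(nat \<Rightarrow> 'a::finite) \<Rightarrow> real"
  assumes h: "continuous_map Xtop euclideanreal h"
  shows "(\<lambda>k. var k h) \<longlonglongrightarrow> 0"
proof (rule LIMSEQ_I)
  fix e :: real assume "0 < e"
  then obtain N where N: "\<And>x y. (\<forall>i<N. x i = y i) \<Longrightarrow> \<bar>h x - h y\<bar> < e / 2"
    using uniform_continuity_Xtop[OF h, of "e/2"] by auto
  obtain B where "\<And>x. \<bar>h x\<bar> \<le> B" using bounded_continuous_Xtop[OF h] by blast
  then have "0 \<le> var k h" for k by (rule var_nonneg)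
  moreover have "var k h \<le> e / 2" if "N \<le> k" for k
    using that N by (intro var_leI less_imp_le) auto
  ultimately have "norm (var k h - 0) < e" if "N \<le> k" for k
    using \<open>0 < e\<close> that by (simp add: order_le_less_trans[of "var k h" "e / 2" e])
  then show "\<exists>N. \<forall>k\<ge>N. norm (var k h - 0) < e" by blast
qed

lemma abs_le_supnorm:
  fixes h :: "(nat \<Rightarrow> 'a::finite) \<Rightarrow> real"
  assumes "continuous_map Xtop euclideanreal h"
  shows "\<bar>h x\<bar> \<le> supnorm h"
proof -
  obtain B where "\<And>x. \<bar>h x\<bar> \<le> B" using bounded_continuous_Xtop[OF assms] by blast
  then show ?thesis unfolding supnorm_def by (intro cSUP_upper bdd_aboveI2) auto
qed

text \<open>\<open>block_chain\<close> is applied to \<open>g0\<close> with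
  \<open>q k = exp (- var k (log g0))\<close>, so that the product of the \<open>q i\<close> is
  \<open>exp (- svar)\<close>. The relation for prepending a letter is exact for
  \<open>\<mu>\<close>, as \<open>g0\<close> is constant on cylinders of length
  \<open>l + 1\<close>, and holds for \<open>\<nu>\<close> up to relative error
  \<open>exp \<delta> - 1\<close>.\<close>

lemma g_measure_perturbation:
  fixes g0 g1 :: "(nat \<Rightarrow> 'a::finite) \<Rightarrow> real"
  assumes g0: "g_function g0" and lc: "locally_constant (l + 1) g0"
    and \<mu>: "compatible_g_measure g0 \<mu>" and \<nu>: "compatible_g_measure g1 \<nu>"
    and g1_pos: "\<And>x. 0 < g1 x"
    and \<delta>: "\<And>x. \<bar>ln (g1 x / g0 x)\<bar> \<le> \<delta>"
    and l: "0 < l" and w: "length w \<le> l"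
  shows "\<bar>measure \<nu> (cyl w) - measure \<mu> (cyl w)\<bar>
    \<le> (exp \<delta> - 1) * real (length w) * exp (svar l (\<lambda>x. ln (g0 x)))"
proof -
  \<comment> \<open>Entries of \<open>u ! i\<close> past the end are arbitrary but not seen by
    \<open>g0\<close> once \<open>u\<close> has \<open>l + 1\<close> letters.\<close>
  define G where "G u = g0 (\<lambda>i. u ! i)" for u
  define q where "q k = exp (- var k (\<lambda>x. ln (g0 x)))" for k
  have g0_pos: "0 < g0 x" for x using g0 by (simp add: g_function_def)
  obtain B where B: "\<And>x. \<bar>ln (g0 x)\<bar> \<le> B"
    using bounded_continuous_Xtop[OF continuous_map_ln_g_function[OF g0]] by blast
  have G: "g0 x = G u" if "length u = Suc l" "x \<in> cyl u" for x u
    using lc that unfolding locally_constant_def G_def cyl_def by auto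
  interpret block_chain l G q
  proof
    fix v :: "'a list" and a :: 'a
    show "0 \<le> G (a # v)" using g0_pos by (simp add: G_def less_imp_le)
    define y where "y = (case_nat a (\<lambda>i. v ! i) :: nat \<Rightarrow> 'a)"
    have "(\<lambda>i. (b # v) ! i) = case_nat b (shiftT y)" for b
      by (auto simp: y_def shiftT_def fun_eq_iff nth_Cons split: nat.split)
    moreover have "(\<Sum>b\<in>UNIV. g0 (case_nat b (shiftT y))) = 1"
      using g0 unfolding g_function_def by blast
    ultimately show "(\<Sum>a\<in>UNIV. G (a # v)) = 1" by (simp add: G_def)
  next
    fix k
    show "q k \<le> 1" using var_nonneg[of "\<lambda>x. ln (g0 x)" B k] B by (simp add: q_def)
  next
    fix k and v v' :: "'a list" and a :: 'a
    assume k: "k < l" "length v = l" "length v' = l" "take k v = take k v'"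
    have in_cyl: "(\<lambda>i. (a # u) ! i) \<in> cyl (a # take k u)" if "length u = l" for u
      using that k by (auto simp: cyl_def nth_Cons split: nat.split)
    have "ln (G (a # v')) - ln (G (a # v)) \<le> var (Suc k) (\<lambda>x. ln (g0 x))"
      using abs_diff_le_var[of "\<lambda>x. ln (g0 x)" B "\<lambda>i. (a # v') ! i" "a # take k v" "\<lambda>i. (a # v) ! i"]
        B in_cyl[of v] in_cyl[of v'] k
      by (simp add: G_def abs_le_iff)
    then have "exp (- var (Suc k) (\<lambda>x. ln (g0 x)) + ln (G (a # v'))) \<le> exp (ln (G (a # v)))"
      by simp
    then show "q (Suc k) * G (a # v') \<le> G (a # v)"
      using g0_pos unfolding exp_add by (simp add: q_def G_def)
  qed (use l in \<open>simp_all add: q_def\<close>)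
  have \<delta>_nonneg: "0 \<le> \<delta>" using \<delta>[of undefined] by simp
  have ln_bounds: "ln (g0 x) - \<delta> \<le> ln (g1 x)" "ln (g1 x) \<le> ln (g0 x) + \<delta>" for x
    using \<delta>[of x] ln_div[of "g1 x" "g0 x"] g1_pos[of x] g0_pos[of x] by (auto simp: abs_le_iff)
  have upper: "g1 x \<le> exp \<delta> * g0 x" for x
    using ln_bounds(2)[of x] g0_pos[of x] g1_pos[of x] exp_le_cancel_iff[of "ln (g1 x)" "ln (g0 x) + \<delta>"]
    by (simp add: exp_add mult.commute)
  have lower: "exp (- \<delta>) * g0 x \<le> g1 x" for x
    using ln_bounds(1)[of x] g0_pos[of x] g1_pos[of x] exp_le_cancel_iff[of "- \<delta> + ln (g0 x)" "ln (g1 x)"]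
    unfolding exp_add by simp
  have "\<bar>measure \<nu> (cyl w) - measure \<mu> (cyl w)\<bar> \<le> (exp \<delta> - 1) * real (length w) / (\<Prod>i=1..l. q i)"
  proof (rule cyl_law_perturbation[OF compatible_cyl_law[OF \<mu>] compatible_cyl_law[OF \<nu>]])
    fix a :: 'a and v :: "'a list" assume v: "length v = l"
    have G_av: "g0 x = G (a # v)" if "x \<in> cyl (a # v)" for x
      using G that v by simp
    show "measure \<mu> (cyl (a # v)) = G (a # v) * measure \<mu> (cyl v)"
      by (intro antisym compatible_ratio_le[OF \<mu>] compatible_ratio_ge[OF \<mu>]) (simp_all add: G_av)
    define m where "m = measure \<nu> (cyl v)"
    have "measure \<nu> (cyl (a # v)) \<le> (exp \<delta> * G (a # v)) * m"
      unfolding m_def using upper G_av by (intro compatible_ratio_le[OF \<nu>]) metis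
    moreover have "(exp (- \<delta>) * G (a # v)) * m \<le> measure \<nu> (cyl (a # v))"
      unfolding m_def using lower G_av by (intro compatible_ratio_ge[OF \<nu>]) metis
    \<comment> \<open>The relative error from below is no larger than the one from above, so a
      single constant covers both.\<close>
    moreover have "(1 - exp (- \<delta>)) * (G (a # v) * m) \<le> (exp \<delta> - 1) * (G (a # v) * m)"
    proof (rule mult_right_mono)
      have "1 + \<delta> \<le> exp \<delta>" "1 + (- \<delta>) \<le> exp (- \<delta>)" by (rule exp_ge_add_one_self)+
      then show "1 - exp (- \<delta>) \<le> exp \<delta> - 1" by linarith
      show "0 \<le> G (a # v) * m" using g0_pos by (simp add: G_def m_def less_imp_le)
    qed
    ultimately show "\<bar>measure \<nu> (cyl (a # v)) - G (a # v) * measure \<nu> (cyl v)\<bar>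
        \<le> (exp \<delta> - 1) * (G (a # v) * measure \<nu> (cyl v))"
      unfolding m_def[symmetric] by (simp add: abs_le_iff algebra_simps)
  qed (use w \<delta>_nonneg in simp_all)
  also have "(\<Prod>i=1..l. q i) = exp (- svar l (\<lambda>x. ln (g0 x)))"
    by (simp add: q_def svar_def exp_sum sum_negf flip: sum_negf)
  finally show ?thesis by (simp add: exp_minus divide_simps)
qed

text \<open>Cesaro averaging: terms from \<open>M\<close> on contribute at most \<open>e / 2\<close>
  each, and the fixed contribution \<open>C\<close> of the earlier ones is absorbed by the other
  half of \<open>e * n\<close>.\<close>

lemma sum_le_eps_mult:
  fixes v :: "nat \<Rightarrow> real"
  assumes v: "v \<longlonglongrightarrow> 0" and e: "0 < e"
  shows "\<exists>N. \<forall>n\<ge>N. (\<Sum>k=1..n. v k) \<le> e * real n"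
proof -
  have "\<forall>\<^sub>F k in sequentially. v k < e / 2"
    using e by (intro order_tendstoD(2)[OF v]) simp
  then obtain M where M: "\<And>k. M \<le> k \<Longrightarrow> v k \<le> e / 2"
    unfolding eventually_sequentially using less_imp_le by metis
  define C where "C = (\<Sum>k\<in>{..<M}. \<bar>v k\<bar>)"
  have bound: "(\<Sum>k=1..n. v k) \<le> C + e / 2 * real n" for n
  proof -
    have "(\<Sum>k=1..n. v k) \<le> (\<Sum>k=1..n. (if k < M then \<bar>v k\<bar> else 0) + e / 2)"
      using M e by (intro sum_mono) (auto simp: not_less intro: order_trans[OF abs_ge_self])
    also have "\<dots> = (\<Sum>k=1..n. if k < M then \<bar>v k\<bar> else 0) + e / 2 * real n"
      by (simp add: sum.distrib)
    also have "(\<Sum>k=1..n. if k < M then \<bar>v k\<bar> else 0) = (\<Sum>k\<in>{1..n} \<inter> {..<M}. \<bar>v k\<bar>)"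
      by (simp add: sum.inter_restrict)
    also have "\<dots> \<le> C" unfolding C_def by (intro sum_mono2) auto
    finally show ?thesis by simp
  qed
  obtain N where N: "C \<le> e / 2 * real N"
  proof -
    obtain N where "C / (e / 2) < real N" using reals_Archimedean2 by blast
    then have "C \<le> e / 2 * real N" using e by (simp add: field_simps)
    then show thesis by (rule that)
  qed
  have "(\<Sum>k=1..n. v k) \<le> e * real n" if "N \<le> n" for n
  proof -
    have "e / 2 * real N \<le> e / 2 * real n" using that e by (intro mult_left_mono) auto
    with bound[of n] N show ?thesis by (simp add: field_simps)
  qed
  then show ?thesis by blast
qed

section \<open>The limit of the approximating measures\<close>

lemma exp_minus_one_le:
  fixes x :: real
  assumes "0 \<le> x" "x \<le> 1"
  shows "exp x - 1 \<le> 2 * x"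
proof -
  have "x\<^sup>2 \<le> x" using assms by (simp add: power2_eq_square mult_left_le)
  then show ?thesis using exp_bound[OF assms] by linarith
qed

locale g_approximation =
  fixes gs :: "nat \<Rightarrow> (nat \<Rightarrow> 'a::finite) \<Rightarrow> real"
    and g :: "(nat \<Rightarrow> 'a) \<Rightarrow> real"
    and \<mu>s :: "nat \<Rightarrow> (nat \<Rightarrow> 'a) measure"
  assumes gs_g: "\<And>l. g_function (gs l)"
    and gs_lc: "\<And>l. locally_constant (l + 1) (gs l)"
    and g_g: "g_function g"
    and \<mu>s: "\<And>l. compatible_g_measure (gs l) (\<mu>s l)"
    and hyp: "(\<lambda>l. supnorm (\<lambda>x. ln (g x / gs l x)) * exp (svar l (\<lambda>x. ln (gs l x)))) \<longlonglongrightarrow> 0"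
begin

definition dev :: "nat \<Rightarrow> real" where
  "dev l = supnorm (\<lambda>x. ln (g x / gs l x))"

definition S :: "nat \<Rightarrow> real" where
  "S l = svar l (\<lambda>x. ln (gs l x))"

definition p :: "nat \<Rightarrow> 'a list \<Rightarrow> real" where
  "p l w = measure (\<mu>s l) (cyl w)"

lemma g_pos: "0 < g x" and gs_pos: "0 < gs l x"
  using g_g gs_g[of l] by (simp_all add: g_function_def)

lemma cyl_law_p: "cyl_law (p l)"
  using compatible_cyl_law[OF \<mu>s] by (simp add: p_def[abs_def])

lemma abs_ln_ratio_le_dev: "\<bar>ln (g x / gs l x)\<bar> \<le> dev l"
  unfolding dev_def
proof (rule abs_le_supnorm)
  have "ln (g x / gs l x) = ln (g x) - ln (gs l x)" for x
    using g_pos[of x] gs_pos[of l x] by (simp add: ln_div)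
  then show "continuous_map Xtop euclideanreal (\<lambda>x. ln (g x / gs l x))"
    using continuous_map_ln_g_function[OF g_g] continuous_map_ln_g_function[OF gs_g[of l]]
    by (simp add: continuous_map_diff)
qed

lemma dev_nonneg: "0 \<le> dev l"
  using abs_ln_ratio_le_dev[of undefined l] by simp

lemma S_nonneg: "0 \<le> S l"
proof -
  obtain B where "\<And>x. \<bar>ln (gs l x)\<bar> \<le> B"
    using bounded_continuous_Xtop[OF continuous_map_ln_g_function[OF gs_g[of l]]] by blast
  then show ?thesis unfolding S_def svar_def by (intro sum_nonneg var_nonneg)
qed

lemma dev_exp_S: "(\<lambda>l. dev l * exp (S l)) \<longlonglongrightarrow> 0"
  using hyp by (simp add: dev_def S_def)

text \<open>\<open>S l\<close> is nonnegative, so the exponential factor in the hypothesis is at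
  least 1.\<close>

lemma dev_tendsto_0: "dev \<longlonglongrightarrow> 0"
proof (rule tendsto_sandwich[OF _ _ tendsto_const dev_exp_S])
  have "dev l * 1 \<le> dev l * exp (S l)" for l
    using S_nonneg dev_nonneg by (intro mult_left_mono) auto
  then show "\<forall>\<^sub>F l in sequentially. dev l \<le> dev l * exp (S l)" by simp
qed (simp add: dev_nonneg)

lemma gs_le: "gs l x \<le> exp (dev l) * g x" and gs_ge: "exp (- dev l) * g x \<le> gs l x"
proof -
  have *: "\<bar>ln (g x) - ln (gs l x)\<bar> \<le> dev l"
    using abs_ln_ratio_le_dev[of x l] g_pos[of x] gs_pos[of l x] by (simp add: ln_div)
  have "exp (ln (gs l x)) \<le> exp (dev l + ln (g x))" using * by (simp add: abs_le_iff)
  then show "gs l x \<le> exp (dev l) * g x" unfolding exp_add using g_pos gs_pos by simp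
  have "exp (- dev l + ln (g x)) \<le> exp (ln (gs l x))" using * by (simp add: abs_le_iff)
  then show "exp (- dev l) * g x \<le> gs l x" unfolding exp_add using g_pos gs_pos by simp
qed

lemma perturbation:
  assumes \<nu>: "compatible_g_measure g1 \<nu>" and pos: "\<And>x. 0 < g1 x"
    and \<delta>: "\<And>x. \<bar>ln (g1 x / gs l x)\<bar> \<le> \<delta>" "\<delta> \<le> 1"
    and l: "0 < l" "length w \<le> l"
  shows "\<bar>measure \<nu> (cyl w) - p l w\<bar> \<le> 2 * real (length w) * (\<delta> * exp (S l))"
proof -
  have "0 \<le> \<delta>" using \<delta>(1)[of undefined] by simp
  have "\<bar>measure \<nu> (cyl w) - p l w\<bar> \<le> (exp \<delta> - 1) * real (length w) * exp (S l)"
    unfolding p_def S_def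
    by (rule g_measure_perturbation[OF gs_g gs_lc \<mu>s \<nu> pos \<delta>(1) l])
  also have "\<dots> \<le> (2 * \<delta>) * real (length w) * exp (S l)"
    using exp_minus_one_le[OF \<open>0 \<le> \<delta>\<close> \<delta>(2)] by (intro mult_right_mono) auto
  finally show ?thesis by (simp add: algebra_simps)
qed

text \<open>Since \<open>\<nu>\<close> is an arbitrary compatible measure for \<open>g\<close>, its
  cylinder probabilities are forced to be the limits of \<open>p l\<close>. This is what gives
  uniqueness.\<close>

lemma p_tendsto:
  assumes \<nu>: "compatible_g_measure g \<nu>"
  shows "(\<lambda>l. p l w) \<longlonglongrightarrow> measure \<nu> (cyl w)"
proof -
  have "\<forall>\<^sub>F l in sequentially. dev l < 1" using dev_tendsto_0 by (rule order_tendstoD) simp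
  then have "\<forall>\<^sub>F l in sequentially. norm (p l w - measure \<nu> (cyl w)) \<le> 2 * real (length w) * (dev l * exp (S l))"
    using eventually_gt_at_top[of 0] eventually_ge_at_top[of "length w"]
  proof eventually_elim
    case (elim l)
    then show ?case
      using perturbation[OF \<nu> g_pos abs_ln_ratio_le_dev, of l w] by (simp add: abs_minus_commute)
  qed
  moreover have "(\<lambda>l. 2 * real (length w) * (dev l * exp (S l))) \<longlonglongrightarrow> 0"
    using tendsto_mult[OF tendsto_const dev_exp_S, of "2 * real (length w)"] by simp
  ultimately have "(\<lambda>l. p l w - measure \<nu> (cyl w)) \<longlonglongrightarrow> 0"
    by (rule Lim_null_comparison)
  then show ?thesis by (simp add: LIM_zero_iff)
qed

text \<open>Comparing \<open>gs m\<close> with \<open>gs l\<close> costs \<open>dev l + dev m\<close>; with \<open>l\<close> fixed, the contribution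
  \<open>dev m * exp (S l)\<close> disappears as \<open>m\<close> grows.\<close>

lemma p_convergent: "convergent (\<lambda>l. p l w)"
proof (rule Cauchy_convergent, rule CauchyI')
  fix e :: real assume e: "0 < e"
  define c where "c = 2 * real (length w)"
  have c: "0 \<le> c" by (simp add: c_def)
  \<comment> \<open>With this choice \<open>c * (2 * t)\<close> equals \<open>e / 2\<close> times
    \<open>c / (c + 1)\<close>; the added 1 also covers the empty word, where
    \<open>c = 0\<close>.\<close>
  define t where "t = e / (4 * (c + 1))"
  have t: "0 < t" "c * (2 * t) < e / 2 + 0"
    using e c by (auto simp: t_def field_simps intro: add_nonneg_pos)
  have "\<forall>\<^sub>F l in sequentially. 0 < l \<and> length w \<le> l \<and> dev l < 1/2 \<and> dev l * exp (S l) < t"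
    using order_tendstoD(2)[OF dev_tendsto_0, of "1/2"] order_tendstoD(2)[OF dev_exp_S t(1)]
    by (intro eventually_conj eventually_gt_at_top eventually_ge_at_top) auto
  then obtain l where l: "0 < l" "length w \<le> l" "dev l < 1/2" "dev l * exp (S l) < t"
    using eventually_happens'[OF sequentially_bot] by blast
  \<comment> \<open>The threshold may depend on \<open>S l\<close> because \<open>l\<close> is
    already fixed; its factor \<open>exp (- S l)\<close> cancels the exponential in the perturbation
    bound.\<close>
  have "\<forall>\<^sub>F m in sequentially. dev m < 1/2 \<and> dev m < t * exp (- S l)"
    using order_tendstoD(2)[OF dev_tendsto_0, of "1/2"]
      order_tendstoD(2)[OF dev_tendsto_0, of "t * exp (- S l)"] t(1)
    by (intro eventually_conj) auto
  then obtain M where M: "\<And>m. M \<le> m \<Longrightarrow> dev m < 1/2 \<and> dev m < t * exp (- S l)"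
    unfolding eventually_sequentially by blast
  have close: "\<bar>p m w - p l w\<bar> < e / 2" if m: "M \<le> m" for m
  proof -
    have "\<bar>ln (gs m x / gs l x)\<bar> \<le> dev l + dev m" for x
      using abs_ln_ratio_le_dev[of x l] abs_ln_ratio_le_dev[of x m] g_pos[of x] gs_pos[of l x] gs_pos[of m x]
      by (simp add: ln_div)
    then have "\<bar>p m w - p l w\<bar> \<le> c * ((dev l + dev m) * exp (S l))"
      using M[OF m] l perturbation[OF \<mu>s[of m] gs_pos[of m], of l "dev l + dev m" w]
      by (simp add: p_def[of m] c_def)
    also have "\<dots> \<le> c * (2 * t)"
    proof (rule mult_left_mono[OF _ c])
      have "dev m * exp (S l) \<le> t * exp (- S l) * exp (S l)"
        using M[OF m] by (intro mult_right_mono) auto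
      also have "\<dots> = t" by (simp add: mult.assoc flip: exp_add)
      finally show "(dev l + dev m) * exp (S l) \<le> 2 * t"
        using l(4) by (simp add: distrib_right)
    qed
    finally show ?thesis using t by simp
  qed
  show "\<exists>M. \<forall>m\<ge>M. \<forall>n>m. dist (p m w) (p n w) < e"
  proof (intro exI[of _ M] allI impI)
    fix m n assume "M \<le> m" "m < n"
    then show "dist (p m w) (p n w) < e"
      using close[of m] close[of n] by (simp add: dist_real_def abs_if split: if_splits)
  qed
qed

section \<open>The limiting cylinder law\<close>

definition limit_law :: "'a list \<Rightarrow> real" where
  "limit_law w = lim (\<lambda>l. p l w)"

lemma p_tendsto_limit_law: "(\<lambda>l. p l w) \<longlonglongrightarrow> limit_law w"
  using p_convergent unfolding limit_law_def by (simp add: convergent_LIMSEQ_iff)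

text \<open>Stating the bound through \<open>g\<close> instead of \<open>gs l\<close> confines the
  dependence of the factor on \<open>l\<close> to \<open>exp (dev l)\<close>, which tends to
  1.\<close>

lemma p_ratio_le:
  assumes "\<And>x. x \<in> cyl (a # w) \<Longrightarrow> g x \<le> B"
  shows "p l (a # w) \<le> exp (dev l) * B * p l w"
  unfolding p_def
proof (rule compatible_ratio_le[OF \<mu>s])
  fix x assume "x \<in> cyl (a # w)"
  then have "exp (dev l) * g x \<le> exp (dev l) * B" using assms by simp
  with gs_le[of l x] show "gs l x \<le> exp (dev l) * B" by linarith
qed

lemma p_ratio_ge:
  assumes "\<And>x. x \<in> cyl (a # w) \<Longrightarrow> A \<le> g x"
  shows "exp (- dev l) * A * p l w \<le> p l (a # w)"
  unfolding p_def
proof (rule compatible_ratio_ge[OF \<mu>s])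
  fix x assume "x \<in> cyl (a # w)"
  then have "exp (- dev l) * A \<le> exp (- dev l) * g x" using assms by simp
  with gs_ge[of l x] show "exp (- dev l) * A \<le> gs l x" by linarith
qed

lemma limit_law_ratio_le:
  assumes "\<And>x. x \<in> cyl (a # w) \<Longrightarrow> g x \<le> B"
  shows "limit_law (a # w) \<le> B * limit_law w"
proof (rule LIMSEQ_le[OF p_tendsto_limit_law])
  have "(\<lambda>l. exp (dev l) * B * p l w) \<longlonglongrightarrow> exp 0 * B * limit_law w"
    by (intro tendsto_intros p_tendsto_limit_law dev_tendsto_0)
  then show "(\<lambda>l. exp (dev l) * B * p l w) \<longlonglongrightarrow> B * limit_law w" by simp
qed (use p_ratio_le[OF assms] in blast)

lemma limit_law_ratio_ge:
  assumes "\<And>x. x \<in> cyl (a # w) \<Longrightarrow> A \<le> g x"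
  shows "A * limit_law w \<le> limit_law (a # w)"
proof (rule LIMSEQ_le[OF _ p_tendsto_limit_law])
  have "(\<lambda>l. exp (- dev l) * A * p l w) \<longlonglongrightarrow> exp (- 0) * A * limit_law w"
    by (intro tendsto_intros p_tendsto_limit_law dev_tendsto_0)
  then show "(\<lambda>l. exp (- dev l) * A * p l w) \<longlonglongrightarrow> A * limit_law w" by simp
qed (use p_ratio_ge[OF assms] in blast)

text \<open>The finite sum rules pass to the limit, but strict positivity does not. It is obtained
  by prepending letters one at a time, each costing at most a factor equal to the positive lower
  bound \<open>exp (- B)\<close> of \<open>g\<close>.\<close>

lemma cyl_law_limit_law: "cyl_law limit_law"
proof -
  have Nil: "limit_law [] = 1"
    using LIMSEQ_unique[OF p_tendsto_limit_law[of "[]"]] cyl_law_Nil[OF cyl_law_p] by simp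
  have "limit_law w = (\<Sum>a\<in>UNIV. limit_law (w @ [a]))" for w
    using tendsto_sum[of UNIV "\<lambda>a l. p l (w @ [a])" "\<lambda>a. limit_law (w @ [a])"] p_tendsto_limit_law
      LIMSEQ_unique[OF p_tendsto_limit_law[of w]] by (simp add: cyl_law_snoc[OF cyl_law_p])
  moreover have "limit_law w = (\<Sum>a\<in>UNIV. limit_law (a # w))" for w
    using tendsto_sum[of UNIV "\<lambda>a l. p l (a # w)" "\<lambda>a. limit_law (a # w)"] p_tendsto_limit_law
      LIMSEQ_unique[OF p_tendsto_limit_law[of w]] by (simp add: cyl_law_Cons[OF cyl_law_p])
  moreover have "0 < limit_law w" for w
  proof (induction w)
    case Nil
    then show ?case using \<open>limit_law [] = 1\<close> by simp
  next
    case (Cons a w)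
    obtain B where B: "\<And>x. \<bar>ln (g x)\<bar> \<le> B"
      using bounded_continuous_Xtop[OF continuous_map_ln_g_function[OF g_g]] by blast
    have "exp (- B) \<le> g x" for x
      using B[of x] g_pos[of x] exp_le_cancel_iff[of "- B" "ln (g x)"] by (simp add: abs_le_iff)
    then have "exp (- B) * limit_law w \<le> limit_law (a # w)" by (rule limit_law_ratio_ge)
    moreover have "0 < exp (- B) * limit_law w" using Cons by simp
    ultimately show ?case by linarith
  qed
  ultimately show ?thesis unfolding cyl_law_def using Nil by blast
qed

text \<open>By continuity \<open>g\<close> is within \<open>e / 2\<close> of \<open>g x\<close> on a
  long enough cylinder around \<open>x\<close>, and the ratio inherits these bounds.\<close>

lemma limit_law_ratio_tendsto:
  "(\<lambda>n. limit_law (word x 0 n) / limit_law (word x 1 n)) \<longlonglongrightarrow> g x"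
proof (rule LIMSEQ_I)
  fix e :: real assume "0 < e"
  have "continuous_map Xtop euclideanreal g" using g_g by (simp add: g_function_def)
  then obtain N where N: "\<And>x y. (\<forall>i<N. x i = y i) \<Longrightarrow> \<bar>g x - g y\<bar> < e / 2"
    using uniform_continuity_Xtop[of g "e / 2"] \<open>0 < e\<close> by auto
  have "norm (limit_law (word x 0 n) / limit_law (word x 1 n) - g x) < e" if n: "Suc N \<le> n" for n
  proof -
    have eq: "word x 0 n = x 0 # word x 1 n"
      using n by (auto simp: word_def upt_conv_Cons simp del: upt_Suc)
    have near: "g y \<le> g x + e / 2 \<and> g x - e / 2 \<le> g y" if "y \<in> cyl (x 0 # word x 1 n)" for y
    proof -
      have "\<bar>g y - g x\<bar> < e / 2"
        using that N[of y x] n unfolding eq[symmetric] cyl_word by auto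
      then show ?thesis by linarith
    qed
    have "limit_law (word x 0 n) \<le> (g x + e / 2) * limit_law (word x 1 n)"
      unfolding eq by (rule limit_law_ratio_le) (use near in blast)
    moreover have "(g x - e / 2) * limit_law (word x 1 n) \<le> limit_law (word x 0 n)"
      unfolding eq by (rule limit_law_ratio_ge) (use near in blast)
    ultimately have "limit_law (word x 0 n) / limit_law (word x 1 n) \<le> g x + e / 2"
      "g x - e / 2 \<le> limit_law (word x 0 n) / limit_law (word x 1 n)"
      using cyl_law_pos[OF cyl_law_limit_law, of "word x 1 n"] by (simp_all add: pos_divide_le_eq pos_le_divide_eq)
    then show ?thesis using \<open>0 < e\<close> by (simp add: abs_less_iff)
  qed
  then show "\<exists>N. \<forall>n\<ge>N. norm (limit_law (word x 0 n) / limit_law (word x 1 n) - g x) < e" by blast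
qed

text \<open>Prepending a letter adds to both logarithms the value of \<open>log g\<close> at one
  reference point \<open>y\<close>. Each law deviates from this by at most \<open>v\<close>, which
  explains the factor 2, and \<open>p l\<close> by a further \<open>dev l\<close>.\<close>

lemma abs_ln_p_limit_law_le:
  "\<bar>ln (p l w) - ln (limit_law w)\<bar>
    \<le> real (length w) * dev l + 2 * (\<Sum>k=1..length w. var k (\<lambda>x. ln (g x)))"
proof (induction w)
  case Nil
  then show ?case by (simp add: cyl_law_Nil[OF cyl_law_p] cyl_law_Nil[OF cyl_law_limit_law])
next
  case (Cons a w)
  define v where "v = var (Suc (length w)) (\<lambda>x. ln (g x))"
  obtain y where y: "y \<in> cyl (a # w)" using cyl_nonempty by blast
  obtain B where B: "\<And>x. \<bar>ln (g x)\<bar> \<le> B"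
    using bounded_continuous_Xtop[OF continuous_map_ln_g_function[OF g_g]] by blast
  have v: "\<bar>ln (g x) - ln (g y)\<bar> \<le> v" if "x \<in> cyl (a # w)" for x
    using abs_diff_le_var[of "\<lambda>x. ln (g x)" B x "a # w" y] B that y by (simp add: v_def)
  define c where "c = ln (g y)"
  have upper: "g x \<le> exp (c + v)" and lower: "exp (c - v) \<le> g x" if "x \<in> cyl (a # w)" for x
    using v[OF that] g_pos[of x] exp_le_cancel_iff[of "ln (g x)" "c + v"]
      exp_le_cancel_iff[of "c - v" "ln (g x)"]
    by (simp_all add: c_def abs_le_iff)
  have pos: "0 < p l u" "0 < limit_law u" for u
    using cyl_law_pos[OF cyl_law_p] cyl_law_pos[OF cyl_law_limit_law] by auto
  have ln_le: "ln s \<le> d + ln t" if "s \<le> exp d * t" "0 < s" "0 < t" for s t d :: real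
    using that ln_le_cancel_iff[of s "exp d * t"] by (simp add: ln_mult)
  have ln_ge: "d + ln t \<le> ln s" if "exp d * t \<le> s" "0 < s" "0 < t" for s t d :: real
    using that ln_le_cancel_iff[of "exp d * t" s] by (simp add: ln_mult)
  have "ln (p l (a # w)) \<le> (dev l + (c + v)) + ln (p l w)"
    using p_ratio_le[OF upper, where l = l] pos by (intro ln_le) (simp_all add: exp_add)
  moreover have "(- dev l + (c - v)) + ln (p l w) \<le> ln (p l (a # w))"
    using p_ratio_ge[OF lower, where l = l] pos unfolding exp_add[symmetric] by (intro ln_ge)
  moreover have "ln (limit_law (a # w)) \<le> (c + v) + ln (limit_law w)"
    using limit_law_ratio_le[OF upper] pos by (intro ln_le)
  moreover have "(c - v) + ln (limit_law w) \<le> ln (limit_law (a # w))"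
    using limit_law_ratio_ge[OF lower] pos by (intro ln_ge)
  ultimately have "\<bar>ln (p l (a # w)) - ln (limit_law (a # w))\<bar>
      \<le> \<bar>ln (p l w) - ln (limit_law w)\<bar> + dev l + 2 * v"
    by (simp add: abs_if split: if_splits)
  then show ?case using Cons by (simp add: v_def algebra_simps)
qed

lemma eventually_abs_ln_p_limit_law_le:
  assumes e: "0 < e"
  shows "\<forall>\<^sub>F l in sequentially. \<forall>w. 0 < length w \<longrightarrow> \<bar>ln (p l w / limit_law w)\<bar> \<le> e * real (length w)"
proof -
  have pos: "0 < p l u" "0 < limit_law u" for l u
    using cyl_law_pos[OF cyl_law_p] cyl_law_pos[OF cyl_law_limit_law] by auto
  \<comment> \<open>For long words, twice \<open>e / 4\<close> from the variations and
    \<open>e / 2\<close> from \<open>dev l\<close> add up to \<open>e\<close> per letter.\<close>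
  obtain N where N: "\<And>n. N \<le> n \<Longrightarrow> (\<Sum>k=1..n. var k (\<lambda>x. ln (g x))) \<le> e / 4 * real n"
    using sum_le_eps_mult[OF var_tendsto_0[OF continuous_map_ln_g_function[OF g_g]], of "e / 4"] e by auto
  have "finite {w :: 'a list. length w \<le> N}"
    using finite_lists_length_le[of "UNIV :: 'a set" N] by simp
  moreover have "\<forall>\<^sub>F l in sequentially. \<bar>ln (p l w / limit_law w)\<bar> < e" for w
  proof (rule order_tendstoD)
    have "(\<lambda>l. \<bar>ln (p l w / limit_law w)\<bar>) \<longlonglongrightarrow> \<bar>ln (limit_law w / limit_law w)\<bar>"
      using pos(2)[of w] by (intro tendsto_intros p_tendsto_limit_law) simp_all
    then show "(\<lambda>l. \<bar>ln (p l w / limit_law w)\<bar>) \<longlonglongrightarrow> 0" using pos(2)[of w] by simp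
  qed (rule e)
  ultimately have "\<forall>\<^sub>F l in sequentially. \<forall>w\<in>{w. length w \<le> N}. \<bar>ln (p l w / limit_law w)\<bar> < e"
    by (intro eventually_ball_finite) auto
  moreover have "\<forall>\<^sub>F l in sequentially. dev l < e / 2"
    using e by (intro order_tendstoD(2)[OF dev_tendsto_0]) simp
  ultimately show ?thesis
  proof eventually_elim
    case (elim l)
    show ?case
    proof (intro allI impI)
      fix w :: "'a list" assume w: "0 < length w"
      show "\<bar>ln (p l w / limit_law w)\<bar> \<le> e * real (length w)"
      proof (cases "length w \<le> N")
        case True
        then have "\<bar>ln (p l w / limit_law w)\<bar> < e" using elim(1) by simp
        moreover have "e * 1 \<le> e * real (length w)" using w e by (intro mult_left_mono) linarith+
        ultimately show ?thesis by simp
      next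
        case False
        have "\<bar>ln (p l w / limit_law w)\<bar> = \<bar>ln (p l w) - ln (limit_law w)\<bar>"
          using pos(1)[of l w] pos(2)[of w] by (simp add: ln_div)
        moreover have "real (length w) * dev l \<le> real (length w) * (e / 2)"
          using elim(2) by (intro mult_left_mono) auto
        ultimately show ?thesis
          using abs_ln_p_limit_law_le[of l w] N[of "length w"] False by (simp add: algebra_simps)
      qed
    qed
  qed
qed

lemma proj_dist_tendsto_0:
  assumes \<mu>: "\<And>w. measure \<mu> (cyl w) = limit_law w"
  shows "(\<lambda>l. proj_dist (\<mu>s l) \<mu>) \<longlonglongrightarrow> 0"
proof (rule order_tendstoI)
  fix a :: ereal assume "a < 0"
  have "0 \<le> proj_dist (\<mu>s l) \<mu>" for l
    unfolding proj_dist_def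
    by (intro SUP_upper2[of 1] SUP_upper2[of "[undefined]"]) auto
  with \<open>a < 0\<close> show "\<forall>\<^sub>F l in sequentially. a < proj_dist (\<mu>s l) \<mu>"
    by (auto intro: always_eventually less_le_trans)
next
  fix a :: ereal assume "0 < a"
  then obtain e where e: "0 < ereal e" "ereal e < a" using ereal_dense2 by blast
  then have "0 < e" by simp
  from eventually_abs_ln_p_limit_law_le[OF this]
  show "\<forall>\<^sub>F l in sequentially. proj_dist (\<mu>s l) \<mu> < a"
  proof eventually_elim
    case (elim l)
    have "proj_dist (\<mu>s l) \<mu> \<le> ereal e"
      unfolding proj_dist_def \<mu> p_def[symmetric]
    proof (intro SUP_least)
      fix n and w :: "'a list" assume "n \<in> {1..}" "w \<in> {w. length w = n}"
      then have "0 < length w" "length w = n" by auto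
      with elim show "ereal (\<bar>ln (p l w / limit_law w)\<bar> / real n) \<le> ereal e"
        by (auto simp: pos_divide_le_eq)
    qed
    with e(2) show ?case by (rule le_less_trans[rotated])
  qed
qed

end

theorem theorem3p4:
  fixes gs :: "nat \<Rightarrow> (nat \<Rightarrow> 'a::finite) \<Rightarrow> real"
    and g :: "(nat \<Rightarrow> 'a) \<Rightarrow> real"
    and \<mu>s :: "nat \<Rightarrow> (nat \<Rightarrow> 'a) measure"
  assumes gs_g: "\<And>l. g_function (gs l)"
    and gs_lc: "\<And>l. locally_constant (l + 1) (gs l)"
    and g_g: "g_function g"
    and conv: "(\<lambda>l. supnorm (\<lambda>x. gs l x - g x)) \<longlonglongrightarrow> 0"
    and \<mu>s: "\<And>l. compatible_g_measure (gs l) (\<mu>s l)"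
    and hyp: "(\<lambda>l. supnorm (\<lambda>x. ln (g x / gs l x)) * exp (svar l (\<lambda>x. ln (gs l x)))) \<longlonglongrightarrow> 0"
  shows "\<exists>\<mu>. (\<lambda>l. proj_dist (\<mu>s l) \<mu>) \<longlonglongrightarrow> 0
            \<and> compatible_g_measure g \<mu>
            \<and> (\<forall>\<nu>. compatible_g_measure g \<nu> \<longrightarrow> \<nu> = \<mu>)"
proof -
  interpret g_approximation gs g \<mu>s
    using gs_g gs_lc g_g \<mu>s hyp by unfold_locales
  obtain \<mu> :: "(nat \<Rightarrow> 'a) measure" where \<mu>: "Mplus \<mu>"
    "\<And>A. A \<in> sets \<mu> \<Longrightarrow> emeasure \<mu> (shiftT -` A) = emeasure \<mu> A"
    "\<And>w. measure \<mu> (cyl w) = limit_law w"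
    by (rule measure_of_cyl_law[OF cyl_law_limit_law]) blast
  have compat: "compatible_g_measure g \<mu>"
    using \<mu> limit_law_ratio_tendsto by (simp add: compatible_g_measure_def)
  moreover have "\<nu> = \<mu>" if \<nu>: "compatible_g_measure g \<nu>" for \<nu>
  proof (rule measure_eqI_cyl)
    show "measure \<nu> (cyl w) = measure \<mu> (cyl w)" for w
      using LIMSEQ_unique[OF p_tendsto[OF \<nu>] p_tendsto[OF compat]] .
  qed (use \<nu> \<mu>(1) in \<open>auto simp: compatible_g_measure_def Mplus_def\<close>)
  ultimately show ?thesis using proj_dist_tendsto_0[OF \<mu>(3)] by blast
qed

end
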